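(* Let $M_1$ and $M_2$ be Garside monoids. Then, for any root $h_1$ of any Garside element in $M_1$ and any root $h_2$ of any Garside element in $M_2$, the cyclic amalgamated free product $M_1\star_{h_1=h_2}M_2$ is a Garside monoid.
   Context: A monoid $M$ is cancellative if $abc=adc$ implies $b=d$ for all $a,b,c,d\in M$; it is conical if $ab=1$ implies $a=b=1$. For $a,b\in M$, $b$ is a left-divisor of $a$ (and $a$ a right-multiple of $b$) if $a=bd$ for some $d\in M$. A right-lcm of $a,b$ is a common right-multiple $c$ of $a$ and $b$ such that every common right-multiple of $a$ and $b$ is a right-multiple of $c$. Right-divisors, left-multiples and left-lcms are defined symmetrically. A Garside element of $M$ is an element whose left-divisors and right-divisors coincide, are finite in number, and generate $M$. A monoid $M$ is Garside if it is conical and cancellative, every pair of elements of $M$ admits a left-lcm and a right-lcm, and $M$ admits a Garside element. A root of an element $g\in M$ is an element $h\in M$ with $h^q=g$ for some integer $q\geq 1$. Given monoids $M_1,M_2,H$ with injective morphisms $\phi_1:H\hookrightarrow M_1$ and $\phi_2:H\hookrightarrow M_2$, the amalgamated free product is the monoid $\langle M_1\star M_2 : \phi_1(k)=\phi_2(k),\ k\in H\rangle^{+}$ (monoid presentation; $\star$ is the free product of monoids). When $H=\langle h\rangle^{+}$ is the infinite cyclic monoid generated by $h$, write $h_i=\phi_i(h)$ for $i\in\{1,2\}$; the amalgamated free product is then denoted $M_1\star_{h_1=h_2}M_2$ and called cyclic (so it is the quotient of $M_1\star M_2$ by the relation $h_1=h_2$; the injectivity of the $\phi_i$ means that each $h_i$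 generates an infinite cyclic submonoid). *)

theory Defs
  imports "HOL-Algebra.Divisibility" "HOL.Hull"
begin

section \<open>Garside monoids\<close>

text \<open>
  The library relation \<open>a divides b\<close> says \<open>b = a \<otimes> c\<close> for some \<open>c\<close> in the carrier, i.e. \<open>a\<close> is a
  left-divisor of \<open>b\<close>.  Hence \<open>c lcmof a b\<close> is the notion of right-lcm.  The
  library has no mirror images of these, so they are given here.
\<close>

definition right_divides :: "('a, 'm) monoid_scheme \<Rightarrow> 'a \<Rightarrow> 'a \<Rightarrow> bool"
  where "right_divides M b a \<longleftrightarrow> (\<exists>d\<in>carrier M. a = d \<otimes>\<^bsub>M\<^esub> b)"

definition is_left_lcm :: "('a, 'm) monoid_scheme \<Rightarrow> 'a \<Rightarrow> 'a \<Rightarrow> 'a \<Rightarrow> bool"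
  where "is_left_lcm M c a b \<longleftrightarrow> right_divides M a c \<and> right_divides M b c \<and>
    (\<forall>d\<in>carrier M. right_divides M a d \<and> right_divides M b d \<longrightarrow> right_divides M c d)"

definition left_divisors :: "('a, 'm) monoid_scheme \<Rightarrow> 'a \<Rightarrow> 'a set"
  where "left_divisors M a = {b \<in> carrier M. b divides\<^bsub>M\<^esub> a}"

definition right_divisors :: "('a, 'm) monoid_scheme \<Rightarrow> 'a \<Rightarrow> 'a set"
  where "right_divisors M a = {b \<in> carrier M. right_divides M b a}"

definition garside_element :: "('a, 'm) monoid_scheme \<Rightarrow> 'a \<Rightarrow> bool"
  where "garside_element M g \<longleftrightarrow> g \<in> carrier M
    \<and> left_divisors M g = right_divisors M g
    \<and> finite (left_divisors M g)
    \<and> (\<lambda>N. submonoid N M) hull left_divisors M g = carrier M"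

locale garside_monoid = monoid_cancel M for M (structure) +
  assumes conical: "\<lbrakk>a \<in> carrier M; b \<in> carrier M; a \<otimes> b = \<one>\<rbrakk> \<Longrightarrow> a = \<one> \<and> b = \<one>"
    and ex_right_lcm: "\<lbrakk>a \<in> carrier M; b \<in> carrier M\<rbrakk> \<Longrightarrow> \<exists>c\<in>carrier M. c lcmof a b"
    and ex_left_lcm: "\<lbrakk>a \<in> carrier M; b \<in> carrier M\<rbrakk> \<Longrightarrow> \<exists>c\<in>carrier M. is_left_lcm M c a b"
    and ex_garside_element: "\<exists>g. garside_element M g"

definition is_root :: "('a, 'm) monoid_scheme \<Rightarrow> 'a \<Rightarrow> 'a \<Rightarrow> bool"
  where "is_root M h g \<longleftrightarrow> h \<in> carrier M \<and> (\<exists>q::nat. 1 \<le> q \<and> h [^]\<^bsub>M\<^esub> q = g)"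


section \<open>Monoid presentations\<close>

text \<open>The least congruence on \<open>M\<close> containing the pairs of \<open>R\<close>.\<close>

inductive_set generated_cong :: "('a, 'm) monoid_scheme \<Rightarrow> ('a \<times> 'a) set \<Rightarrow> ('a \<times> 'a) set"
  for M (structure) and R
  where
    base: "\<lbrakk>(x, y) \<in> R; x \<in> carrier M; y \<in> carrier M\<rbrakk> \<Longrightarrow> (x, y) \<in> generated_cong M R"
  | refl: "x \<in> carrier M \<Longrightarrow> (x, x) \<in> generated_cong M R"
  | sym: "(x, y) \<in> generated_cong M R \<Longrightarrow> (y, x) \<in> generated_cong M R"
  | trans: "\<lbrakk>(x, y) \<in> generated_cong M R; (y, z) \<in> generated_cong M R\<rbrakk>
      \<Longrightarrow> (x, z) \<in> generated_cong M R"
  | mult: "\<lbrakk>(x, x') \<in> generated_cong M R; (y, y') \<in> generated_cong M R\<rbrakk>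
      \<Longrightarrow> (x \<otimes> y, x' \<otimes> y') \<in> generated_cong M R"

definition cong_class :: "('a, 'm) monoid_scheme \<Rightarrow> ('a \<times> 'a) set \<Rightarrow> 'a \<Rightarrow> 'a set"
  where "cong_class M R x = generated_cong M R `` {x}"

definition quotient_monoid :: "('a, 'm) monoid_scheme \<Rightarrow> ('a \<times> 'a) set \<Rightarrow> 'a set monoid"
  where "quotient_monoid M R =
    \<lparr>carrier = carrier M // generated_cong M R,
     mult = (\<lambda>A B. generated_cong M R `` {a \<otimes>\<^bsub>M\<^esub> b | a b. a \<in> A \<and> b \<in> B}),
     one = cong_class M R \<one>\<^bsub>M\<^esub>\<rparr>"

definition free_monoid :: "'a set \<Rightarrow> 'a list monoid"
  where "free_monoid S = \<lparr>carrier = lists S, mult = (@), one = []\<rparr>"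


section \<open>Free products and amalgamated free products\<close>

text \<open>
  The free product is presented by the disjoint union of the two carriers as generators and the
  two multiplication tables (with both units equal to the empty word) as relations.
\<close>

definition free_product_rels ::
    "('a, 'm) monoid_scheme \<Rightarrow> ('b, 'n) monoid_scheme \<Rightarrow> (('a + 'b) list \<times> ('a + 'b) list) set"
  where "free_product_rels M1 M2 =
    {([Inl x, Inl y], [Inl (x \<otimes>\<^bsub>M1\<^esub> y)]) | x y. x \<in> carrier M1 \<and> y \<in> carrier M1} \<union>
    {([Inr x, Inr y], [Inr (x \<otimes>\<^bsub>M2\<^esub> y)]) | x y. x \<in> carrier M2 \<and> y \<in> carrier M2} \<union>
    {([Inl \<one>\<^bsub>M1\<^esub>], []), ([Inr \<one>\<^bsub>M2\<^esub>], [])}"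

definition free_product ::
    "('a, 'm) monoid_scheme \<Rightarrow> ('b, 'n) monoid_scheme \<Rightarrow> ('a + 'b) list set monoid"
  where "free_product M1 M2 =
    quotient_monoid (free_monoid (carrier M1 <+> carrier M2)) (free_product_rels M1 M2)"

definition free_product_inl ::
    "('a, 'm) monoid_scheme \<Rightarrow> ('b, 'n) monoid_scheme \<Rightarrow> 'a \<Rightarrow> ('a + 'b) list set"
  where "free_product_inl M1 M2 x =
    cong_class (free_monoid (carrier M1 <+> carrier M2)) (free_product_rels M1 M2) [Inl x]"

definition free_product_inr ::
    "('a, 'm) monoid_scheme \<Rightarrow> ('b, 'n) monoid_scheme \<Rightarrow> 'b \<Rightarrow> ('a + 'b) list set"
  where "free_product_inr M1 M2 y =
    cong_class (free_monoid (carrier M1 <+> carrier M2)) (free_product_rels M1 M2) [Inr y]"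

text \<open>
  Injectivity of the two morphisms plays no role in the construction; it has to be assumed
  wherever the construction is used.
\<close>

definition amalgamated_free_product ::
    "('a, 'm) monoid_scheme \<Rightarrow> ('b, 'n) monoid_scheme \<Rightarrow> ('h, 'k) monoid_scheme
      \<Rightarrow> ('h \<Rightarrow> 'a) \<Rightarrow> ('h \<Rightarrow> 'b) \<Rightarrow> ('a + 'b) list set set monoid"
  where "amalgamated_free_product M1 M2 H \<phi>1 \<phi>2 =
    quotient_monoid (free_product M1 M2)
      {(free_product_inl M1 M2 (\<phi>1 k), free_product_inr M1 M2 (\<phi>2 k)) | k. k \<in> carrier H}"

text \<open>The infinite cyclic monoid, written additively: \<open>k\<close> stands for the \<open>k\<close>-th power of the generator.\<close>

definition infinite_cyclic_monoid :: "nat monoid"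
  where "infinite_cyclic_monoid = \<lparr>carrier = UNIV, mult = (+), one = 0\<rparr>"

definition cyclic_amalgam ::
    "('a, 'm) monoid_scheme \<Rightarrow> ('b, 'n) monoid_scheme \<Rightarrow> 'a \<Rightarrow> 'b \<Rightarrow> ('a + 'b) list set set monoid"
  where "cyclic_amalgam M1 M2 h1 h2 =
    amalgamated_free_product M1 M2 infinite_cyclic_monoid
      (\<lambda>k. h1 [^]\<^bsub>M1\<^esub> k) (\<lambda>k. h2 [^]\<^bsub>M2\<^esub> k)"

end

theory Submission
  imports Defs "HOL-Combinatorics.Cycles"
begin

text \<open>
  Let \<open>h\<close> be the common image of the two roots. In a Garside monoid every element divides a power of
  a Garside element, hence of its root, and some power of the root is central, because
  conjugation by a Garside element permutes the finite set of its divisors. So both factors are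
  conical cancellative monoids with right-lcms in which each element has finitely many
  factorizations and divides a power of \<open>h\<close>, and in which some power of \<open>h\<close> is central. The
  locale \<open>rooted_monoid\<close> collects these properties, from which all else follows.

  In such a factor, each element is \<open>h ^ k t\<close> for a unique \<open>k\<close> and a unique \<open>t\<close> that \<open>h\<close> does not
  divide. Hence every element of the amalgam is \<open>h ^ k t\<^sub>1 \<dots> t\<^sub>n\<close>, where the \<open>t\<^sub>i\<close> are nontrivial, not
  divisible by \<open>h\<close>, and taken alternately from the two factors. This normal form is unique: the two
  factors act on the set of normal forms as left multiplication should, the two actions agree on
  \<open>h\<close>, so the amalgam acts, and an element is recovered from its effect on the empty normal form. Seen
  from one factor \<open>A\<close>, uniqueness says that the amalgam is a free left \<open>A\<close>-set, whose basis consists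
  of the tails: products \<open>t\<^sub>1 \<dots> t\<^sub>n\<close> that do not start in \<open>A\<close>. This is the
  content of the locale \<open>free_amalgam\<close>, from which the Garside properties are derived.

  Left cancellation and conicality are inherited from the factors through the free action, and right
  cancellation follows from left cancellation since each element divides a central power of \<open>h\<close>.

  Every element has finitely many factorizations. It suffices to see this for \<open>h ^ k\<close>, whose
  right-divisors arise by stripping factor elements off on the left. Within one factor this is
  finite; changing the factor rewrites \<open>h ^ j t\<close> as the power \<open>h ^ j\<close>, now read in the
  other factor, in front of a longer tail, with a strictly smaller exponent. The nested
  induction is \<open>finite_right_divisors_above_tail\<close>.

  Two elements of the same factor have there a right-lcm, which remains one in the amalgam by freeness.
  For \<open>a\<close> and \<open>b\<close> in different factors let \<open>p\<close> and \<open>q\<close> be the least exponents such that \<open>a\<close> divides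
  \<open>h ^ p\<close> and \<open>b\<close> divides \<open>h ^ q\<close>. If \<open>p \<le> q\<close>, then the right-lcm of \<open>a\<close> and \<open>b\<close> is that of
  \<open>h ^ p\<close> and \<open>b\<close> in the factor of \<open>b\<close> (\<open>mixed_lcm\<close>). From generators the right-lcms extend to all
  elements by Noetherian induction (\<open>right_lcm_from_generators\<close>). Left-lcms come by duality: taking
  complements in a central common multiple turns left-gcds into left-lcms (\<open>dual_left_lcm\<close>).
  Finally, a central element of whose powers every element is a divisor is a Garside element as soon
  as right-lcms exist (\<open>central_garside_element\<close>).
\<close>


section \<open>Generating sets\<close>

lemma (in monoid) hull_submonoid_induct [consumes 2, case_names gen one mult]:
  assumes gen: "(\<lambda>N. submonoid N G) hull S = carrier G" and "a \<in> carrier G"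
    and "\<And>s. \<lbrakk>s \<in> S; s \<in> carrier G\<rbrakk> \<Longrightarrow> P s"
    and "P \<one>"
    and "\<And>x y. \<lbrakk>x \<in> carrier G; y \<in> carrier G; P x; P y\<rbrakk> \<Longrightarrow> P (x \<otimes> y)"
  shows "P a"
proof -
  have "S \<subseteq> carrier G"
    using gen hull_subset by metis
  moreover have "submonoid {x \<in> carrier G. P x} G"
    using assms by unfold_locales auto
  ultimately have "(\<lambda>N. submonoid N G) hull S \<subseteq> {x \<in> carrier G. P x}"
    using assms by (intro hull_minimal) auto
  with gen \<open>a \<in> carrier G\<close> show ?thesis by auto
qed

lemma (in monoid) generatedI:
  assumes "S \<subseteq> carrier G"
    and "\<And>N. \<lbrakk>submonoid N G; S \<subseteq> N\<rbrakk> \<Longrightarrow> carrier G \<subseteq> N"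
  shows "(\<lambda>N. submonoid N G) hull S = carrier G"
proof
  show "(\<lambda>N. submonoid N G) hull S \<subseteq> carrier G"
    using assms(1) by (intro hull_minimal) (auto intro!: submonoid.intro)
  show "carrier G \<subseteq> (\<lambda>N. submonoid N G) hull S"
    using assms(2) unfolding hull_def by blast
qed

section \<open>Finitely many factorizations\<close>

definition (in monoid) factorizations :: "'a \<Rightarrow> ('a \<times> 'a) set"
  where "factorizations a = {(b, c). b \<in> carrier G \<and> c \<in> carrier G \<and> b \<otimes> c = a}"

locale finite_factorization_monoid = monoid_cancel G for G (structure) +
  assumes conical: "\<lbrakk>a \<in> carrier G; b \<in> carrier G; a \<otimes> b = \<one>\<rbrakk> \<Longrightarrow> a = \<one> \<and> b = \<one>"
    and finite_factorizations: "a \<in> carrier G \<Longrightarrow> finite (factorizations a)"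

definition (in monoid) num_factorizations :: "'a \<Rightarrow> nat"
  where "num_factorizations a = card (factorizations a)"

lemma (in monoid_cancel) finite_factorizations_iff_right:
  assumes "a \<in> carrier G"
  shows "finite (factorizations a) \<longleftrightarrow> finite (right_divisors G a)"
proof -
  have "inj_on snd (factorizations a)"
    by (intro inj_onI) (auto simp: factorizations_def, metis r_cancel)
  moreover have "snd ` factorizations a = right_divisors G a"
    by (auto simp: factorizations_def right_divisors_def right_divides_def image_iff)
  ultimately show ?thesis by (metis finite_image_iff)
qed

lemma (in monoid_cancel) finite_factorizations_iff_left:
  assumes "a \<in> carrier G"
  shows "finite (factorizations a) \<longleftrightarrow> finite (left_divisors G a)"
proof -
  have "inj_on fst (factorizations a)"
    by (intro inj_onI) (auto simp: factorizations_def, metis l_cancel)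
  moreover have "fst ` factorizations a = left_divisors G a"
    by (force simp: factorizations_def left_divisors_def factor_def image_iff)
  ultimately show ?thesis by (metis finite_image_iff)
qed

context finite_factorization_monoid
begin

text \<open>
  The number of factorizations serves as a Noetherian measure that is strictly monotone on both
  sides: multiplying one component of every factorization of \<open>c\<close> by \<open>b\<close> gives distinct
  factorizations of the product and misses a trivial one.
\<close>

lemma num_factorizations_less_right:
  assumes "b \<in> carrier G" "c \<in> carrier G" "b \<noteq> \<one>"
  shows "num_factorizations c < num_factorizations (b \<otimes> c)"
proof -
  let ?f = "\<lambda>(u, v). (b \<otimes> u, v)"
  have "inj_on ?f (factorizations c)"
    using assms by (auto simp: inj_on_def factorizations_def dest: l_cancel)
  then have card_eq: "num_factorizations c = card (?f ` factorizations c)"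
    by (simp add: num_factorizations_def card_image)
  have "(\<one>, b \<otimes> c) \<notin> ?f ` factorizations c"
    using assms by (auto simp: factorizations_def dest: conical[OF _ _ HOL.sym])
  moreover have "?f ` factorizations c \<union> {(\<one>, b \<otimes> c)} \<subseteq> factorizations (b \<otimes> c)"
    using assms by (auto simp: factorizations_def m_assoc)
  ultimately have "?f ` factorizations c \<subset> factorizations (b \<otimes> c)"
    by blast
  then have "card (?f ` factorizations c) < card (factorizations (b \<otimes> c))"
    using assms by (intro psubset_card_mono finite_factorizations) auto
  with card_eq show ?thesis by (simp add: num_factorizations_def)
qed

lemma num_factorizations_less_left:
  assumes "b \<in> carrier G" "c \<in> carrier G" "c \<noteq> \<one>"
  shows "num_factorizations b < num_factorizations (b \<otimes> c)"
proof -
  let ?f = "\<lambda>(u, v). (u, v \<otimes> c)"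
  have "inj_on ?f (factorizations b)"
    using assms by (auto simp: inj_on_def factorizations_def dest: r_cancel)
  then have card_eq: "num_factorizations b = card (?f ` factorizations b)"
    by (simp add: num_factorizations_def card_image)
  have "(b \<otimes> c, \<one>) \<notin> ?f ` factorizations b"
    using assms by (auto simp: factorizations_def dest: conical[OF _ _ HOL.sym])
  moreover have "?f ` factorizations b \<union> {(b \<otimes> c, \<one>)} \<subseteq> factorizations (b \<otimes> c)"
    using assms by (auto simp: factorizations_def m_assoc)
  ultimately have "?f ` factorizations b \<subset> factorizations (b \<otimes> c)"
    by blast
  then have "card (?f ` factorizations b) < card (factorizations (b \<otimes> c))"
    using assms by (intro psubset_card_mono finite_factorizations) auto
  with card_eq show ?thesis by (simp add: num_factorizations_def)
qed

lemma num_factorizations_le_right: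
  assumes "b \<in> carrier G" "c \<in> carrier G"
  shows "num_factorizations c \<le> num_factorizations (b \<otimes> c)"
  using num_factorizations_less_right[of b c] assms by (cases "b = \<one>") auto

lemma num_factorizations_le_left:
  assumes "b \<in> carrier G" "c \<in> carrier G"
  shows "num_factorizations b \<le> num_factorizations (b \<otimes> c)"
  using num_factorizations_less_left[of b c] assms by (cases "c = \<one>") auto

text \<open>
  Cancellation settles this only if \<open>a\<close> commutes with \<open>b\<close> or \<open>c\<close>; in general, \<open>a\<close> has fewer factorizations than
  any proper multiple of it.
\<close>

lemma not_sandwiched:
  assumes "a \<in> carrier G" "b \<in> carrier G" "c \<in> carrier G" and "b \<otimes> a \<otimes> c = a"
  shows "b = \<one>" "c = \<one>"
proof -
  show "b = \<one>"
    using num_factorizations_less_right[of b a] num_factorizations_le_left[of "b \<otimes> a" c] assms by fastforce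
  show "c = \<one>"
    using num_factorizations_less_left[of "b \<otimes> a" c] num_factorizations_le_right[of b a] assms by fastforce
qed

end

section \<open>Lcms and gcds\<close>

lemma (in monoid) one_divides: "a \<in> carrier G \<Longrightarrow> \<one> divides a"
  by (rule dividesI[of a]) auto

lemma lcmofD:
  assumes "c lcmof\<^bsub>G\<^esub> a b"
  shows "a divides\<^bsub>G\<^esub> c" "b divides\<^bsub>G\<^esub> c"
    "\<lbrakk>d \<in> carrier G; a divides\<^bsub>G\<^esub> d; b divides\<^bsub>G\<^esub> d\<rbrakk> \<Longrightarrow> c divides\<^bsub>G\<^esub> d"
  using assms by (auto simp: islcm_def)

lemma lcmofI:
  assumes "a divides\<^bsub>G\<^esub> c" "b divides\<^bsub>G\<^esub> c"
    "\<And>d. \<lbrakk>d \<in> carrier G; a divides\<^bsub>G\<^esub> d; b divides\<^bsub>G\<^esub> d\<rbrakk> \<Longrightarrow> c divides\<^bsub>G\<^esub> d"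
  shows "c lcmof\<^bsub>G\<^esub> a b"
  using assms by (auto simp: islcm_def)

lemma lcmof_commute: "c lcmof\<^bsub>G\<^esub> a b \<Longrightarrow> c lcmof\<^bsub>G\<^esub> b a"
  by (auto simp: islcm_def)

context monoid_cancel
begin

lemma lcmof_mult_left:
  assumes "c lcmof a b" "x \<in> carrier G" "a \<in> carrier G" "b \<in> carrier G" "c \<in> carrier G"
  shows "(x \<otimes> c) lcmof (x \<otimes> a) (x \<otimes> b)"
proof (rule lcmofI)
  fix d assume d: "d \<in> carrier G" "x \<otimes> a divides d" "x \<otimes> b divides d"
  then obtain u where u: "u \<in> carrier G" "d = x \<otimes> (a \<otimes> u)"
    using assms by (auto simp: factor_def m_assoc)
  with d assms have "a divides a \<otimes> u" "b divides a \<otimes> u" by auto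
  with assms u show "x \<otimes> c divides d" by (auto dest: lcmofD(3))
qed (use assms in \<open>auto dest: lcmofD(1,2)\<close>)

text \<open>The lcm of \<open>x \<otimes> a\<close> and \<open>y\<close> arises from that of \<open>x\<close> and \<open>y\<close> by pushing \<open>a\<close> past the complement \<open>y'\<close>.\<close>

lemma lcmof_extend:
  assumes "(x \<otimes> y') lcmof x y" "c lcmof a y'"
    and "x \<in> carrier G" "y \<in> carrier G" "y' \<in> carrier G" "a \<in> carrier G" "c \<in> carrier G"
  shows "(x \<otimes> c) lcmof (x \<otimes> a) y"
proof (rule lcmofI)
  show "y divides x \<otimes> c"
    using assms by (meson divides_mult_lI divides_trans lcmofD(2))
  fix d assume d: "d \<in> carrier G" "x \<otimes> a divides d" "y divides d"
  then obtain u where u: "u \<in> carrier G" "d = x \<otimes> (a \<otimes> u)"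
    using assms by (auto simp: factor_def m_assoc)
  then have "x divides d" using assms by auto
  with d assms(1) have "x \<otimes> y' divides d" by (blast dest: lcmofD(3))
  with u assms d have "a divides a \<otimes> u" "y' divides a \<otimes> u" by auto
  with assms u show "x \<otimes> c divides d" by (auto dest: lcmofD(3))
qed (use assms in \<open>auto dest: lcmofD(1)\<close>)

end

context finite_factorization_monoid
begin

text \<open>
  The induction is on a common multiple \<open>m\<close>. Write \<open>a = x \<otimes> a1\<close> and \<open>b = y \<otimes> b1\<close> with nontrivial generators
  \<open>x\<close> and \<open>y\<close>. Dividing \<open>m\<close> by \<open>x\<close>, by \<open>y\<close> and by the lcm of \<open>x\<close> and \<open>y\<close> gives three smaller common multiples;
  they yield in turn the lcm of \<open>a\<close> and \<open>y\<close>, that of \<open>b\<close> and \<open>x\<close>, and the lcm of these two, which is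
  that of \<open>a\<close> and \<open>b\<close>.
\<close>

lemma right_lcm_from_generators:
  assumes gen: "(\<lambda>N. submonoid N G) hull S = carrier G"
    and S_lcm: "\<And>x y. \<lbrakk>x \<in> S; y \<in> S; x \<in> carrier G; y \<in> carrier G\<rbrakk> \<Longrightarrow> \<exists>c\<in>carrier G. c lcmof x y"
    and m: "m \<in> carrier G" "a \<in> carrier G" "b \<in> carrier G" "a divides m" "b divides m"
  shows "\<exists>c\<in>carrier G. c lcmof a b"
  using m
proof (induction "num_factorizations m" arbitrary: m a b rule: less_induct)
  case less
  have split: "\<exists>x\<in>S. \<exists>a'\<in>carrier G. x \<in> carrier G \<and> x \<noteq> \<one> \<and> a = x \<otimes> a'"
    if "a \<in> carrier G" "a \<noteq> \<one>" for a
    using gen that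
  proof (induction rule: hull_submonoid_induct)
    case (gen s) then show ?case by (metis r_one one_closed)
  next
    case (mult u v)
    show ?case
    proof (cases "u = \<one>")
      case True with mult show ?thesis by auto
    next
      case False
      with mult obtain x a' where "x \<in> S" "a' \<in> carrier G" "x \<in> carrier G" "x \<noteq> \<one>" "u = x \<otimes> a'"
        by blast
      with mult show ?thesis by (intro bexI[of _ x] bexI[of _ "a' \<otimes> v"]) (auto simp: m_assoc)
    qed
  qed auto
  show ?case
  proof (cases "a = \<one> \<or> b = \<one>")
    case True
    then have "b lcmof a b \<or> a lcmof a b"
      using less.prems by (auto simp: islcm_def one_divides)
    then show ?thesis using less.prems by blast
  next
    case False
    with split less.prems obtain x a1 y b1 where
      x: "x \<in> S" "x \<in> carrier G" "x \<noteq> \<one>" "a1 \<in> carrier G" "a = x \<otimes> a1" and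
      y: "y \<in> S" "y \<in> carrier G" "y \<noteq> \<one>" "b1 \<in> carrier G" "b = y \<otimes> b1"
      by metis
    obtain l where l: "l \<in> carrier G" "l lcmof x y"
      using S_lcm x y by blast
    obtain y' x' where y': "y' \<in> carrier G" "l = x \<otimes> y'" and x': "x' \<in> carrier G" "l = y \<otimes> x'"
      using lcmofD(1,2)[OF l(2)] by (elim dividesE)
    have l_ne: "l \<noteq> \<one>" using y' x conical[of x y'] by auto
    have dm: "x divides m" "y divides m"
      using less.prems x y by (auto intro: divides_trans)
    then have lm: "l divides m" using l less.prems by (auto dest: lcmofD(3))
    obtain m1 where m1: "m1 \<in> carrier G" "m = x \<otimes> m1" using dm(1) by (elim dividesE)
    obtain m2 where m2: "m2 \<in> carrier G" "m = y \<otimes> m2" using dm(2) by (elim dividesE)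
    obtain m3 where m3: "m3 \<in> carrier G" "m = l \<otimes> m3" using lm by (elim dividesE)
    have less_m: "num_factorizations m1 < num_factorizations m" "num_factorizations m2 < num_factorizations m" "num_factorizations m3 < num_factorizations m"
      unfolding m1(2) using num_factorizations_less_right[OF x(2) m1(1) x(3)] num_factorizations_less_right[OF y(2) m2(1) y(3)]
        num_factorizations_less_right[OF l(1) m3(1) l_ne] m1(2) m2(2) m3(2) by simp_all
    have "a1 divides m1" "y' divides m1"
      using less.prems(4) lm m1 x y' by auto
    then obtain c1 where c1: "c1 \<in> carrier G" "c1 lcmof a1 y'"
      using less.hyps[OF less_m(1) m1(1) x(4) y'(1)] by blast
    have "b1 divides m2" "x' divides m2"
      using less.prems(5) lm m2 y x' by auto
    then obtain c2 where c2: "c2 \<in> carrier G" "c2 lcmof b1 x'"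
      using less.hyps[OF less_m(2) m2(1) y(4) x'(1)] by blast
    have L1: "(x \<otimes> c1) lcmof a y"
      using lcmof_extend[of x y' y c1 a1] l y' c1 x y by simp
    have L2: "(y \<otimes> c2) lcmof b x"
      using lcmof_extend[of y x' x c2 b1] lcmof_commute[OF l(2)] x' c2 x y by simp
    obtain u where u: "u \<in> carrier G" "x \<otimes> c1 = l \<otimes> u"
      using lcmofD(2)[OF c1(2)] y' x c1 by (auto simp: factor_def m_assoc)
    obtain v where v: "v \<in> carrier G" "y \<otimes> c2 = l \<otimes> v"
      using lcmofD(2)[OF c2(2)] x' y c2 by (auto simp: factor_def m_assoc)
    have "l \<otimes> u divides m" "l \<otimes> v divides m"
      using L1 L2 less.prems dm u(2) v(2) by (metis lcmofD(3))+
    then have "u divides m3" "v divides m3"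
      using m3 u v l by auto
    then obtain c3 where c3: "c3 \<in> carrier G" "c3 lcmof u v"
      using less.hyps[OF less_m(3) m3(1) u(1) v(1)] by blast
    have L3: "(l \<otimes> c3) lcmof (x \<otimes> c1) (y \<otimes> c2)"
      using lcmof_mult_left[OF c3(2) l(1) u(1) v(1) c3(1)] u v by simp
    have "(l \<otimes> c3) lcmof a b"
    proof (rule lcmofI)
      show "a divides l \<otimes> c3" "b divides l \<otimes> c3"
        using L1 L2 L3 less.prems by (meson divides_trans lcmofD)+
      fix d assume d: "d \<in> carrier G" "a divides d" "b divides d"
      then have "x divides d" "y divides d"
        using x y less.prems by (auto intro: divides_trans[of x a d] divides_trans[of y b d])
      with d L1 L2 L3 show "l \<otimes> c3 divides d" by (meson lcmofD(3))
    qed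
    with l c3 show ?thesis by blast
  qed
qed

text \<open>
  Among the finitely many common divisors, take one with the most factorizations: its lcm with any
  other common divisor is again a common divisor, so it cannot be larger.
\<close>

lemma left_gcd_exists:
  assumes lcm: "\<And>a b. \<lbrakk>a \<in> carrier G; b \<in> carrier G\<rbrakk> \<Longrightarrow> \<exists>c\<in>carrier G. c lcmof a b"
    and ab: "a \<in> carrier G" "b \<in> carrier G"
  shows "\<exists>d\<in>carrier G. d gcdof a b"
proof -
  let ?S = "{e \<in> carrier G. e divides a \<and> e divides b}"
  have "finite (left_divisors G a)"
    using ab finite_factorizations finite_factorizations_iff_left by blast
  then have fin: "finite ?S" by (rule rev_finite_subset) (auto simp: left_divisors_def)
  have one: "\<one> \<in> ?S" using ab by (auto simp: factor_def)
  define n where "n = Max (num_factorizations ` ?S)"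
  have "n \<in> num_factorizations ` ?S" unfolding n_def using fin one by (intro Max_in) auto
  then obtain d where d: "d \<in> ?S" "num_factorizations d = n" by auto
  have d_max: "num_factorizations e \<le> num_factorizations d" if "e \<in> ?S" for e
    unfolding d(2) n_def using fin that by (intro Max_ge) auto
  have "e divides d" if e: "e \<in> ?S" for e
  proof -
    obtain l where l: "l \<in> carrier G" "l lcmof d e" using lcm d(1) e by blast
    then have "l \<in> ?S" using d(1) e ab by (auto dest: lcmofD(3))
    then have le: "num_factorizations l \<le> num_factorizations d" using d_max by blast
    obtain w where w: "w \<in> carrier G" "l = d \<otimes> w"
      using lcmofD(1)[OF l(2)] by (auto simp: factor_def)
    with le d(1) num_factorizations_less_left[of d w] have "w = \<one>" by fastforce
    with w d(1) l show ?thesis by (auto dest: lcmofD(2))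
  qed
  with d(1) show ?thesis by (auto simp: isgcd_def)
qed

end

section \<open>Central elements bounding all others\<close>

text \<open>
  This is the first step of the greedy factorization of a divisor of \<open>g \<otimes> p\<close>, up to conjugation by
  \<open>g\<close>: if \<open>l = x \<otimes> d' = g \<otimes> y\<close> is the lcm of \<open>x\<close> and \<open>g\<close>, then \<open>y\<close> divides \<open>p\<close>, and \<open>x \<otimes> g\<close> is a multiple of
  \<open>l\<close>, which leaves the remainder \<open>d\<close>.
\<close>

lemma (in monoid_cancel) quasi_central_divisor_splits:
  assumes carr: "g \<in> carrier G" "x \<in> carrier G" "x' \<in> carrier G" "p \<in> carrier G" "l \<in> carrier G"
    and quasi: "x \<otimes> g = g \<otimes> x'" and l: "l lcmof x g" and x: "x divides g \<otimes> p"
  shows "\<exists>y\<in>carrier G. \<exists>d\<in>carrier G. x' = y \<otimes> d \<and> y divides p \<and> right_divides G d g"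
proof -
  obtain d' y where d': "d' \<in> carrier G" "l = x \<otimes> d'" and y: "y \<in> carrier G" "l = g \<otimes> y"
    using lcmofD(1,2)[OF l] unfolding factor_def by blast
  have "l divides g \<otimes> p" using carr x l by (auto dest: lcmofD(3))
  then have "y divides p" using y carr by auto
  have "l divides x \<otimes> g"
    using carr quasi l by (metis dividesI' lcmofD(3) m_closed)
  then obtain d where d: "d \<in> carrier G" "x \<otimes> g = l \<otimes> d" by (auto simp: factor_def)
  then have "x \<otimes> g = x \<otimes> (d' \<otimes> d)" using d' carr by (simp add: m_assoc)
  then have "g = d' \<otimes> d" using l_cancel d d' carr by blast
  moreover have "g \<otimes> x' = g \<otimes> (y \<otimes> d)" using d y carr quasi by (simp add: m_assoc)
  then have "x' = y \<otimes> d" using l_cancel d y carr by blast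
  ultimately show ?thesis
    using d d' y \<open>y divides p\<close> by (auto simp: right_divides_def)
qed

lemma (in monoid) central_pow_commute:
  assumes "c \<in> carrier G" "x \<in> carrier G" "x \<otimes> c = c \<otimes> x"
  shows "x \<otimes> c [^] (k::nat) = c [^] k \<otimes> x"
  using assms by (induction k) (auto simp: m_assoc, metis m_assoc nat_pow_closed)

lemma (in monoid) central_power_bounds:
  assumes gen: "(\<lambda>N. submonoid N G) hull S = carrier G"
    and c: "c \<in> carrier G" "\<And>x. x \<in> carrier G \<Longrightarrow> x \<otimes> c = c \<otimes> x"
    and S: "\<And>s. s \<in> S \<Longrightarrow> s \<in> carrier G \<Longrightarrow> \<exists>k::nat. s divides c [^] k"
    and "a \<in> carrier G"
  shows "\<exists>k::nat. a divides c [^] k"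
  using gen \<open>a \<in> carrier G\<close>
proof (induction rule: hull_submonoid_induct)
  case one then show ?case by (intro exI[of _ 0]) simp
next
  case (mult x y)
  then obtain k l :: nat and u v where
    u: "u \<in> carrier G" "c [^] k = x \<otimes> u" and v: "v \<in> carrier G" "c [^] l = y \<otimes> v"
    by (auto simp: factor_def)
  have "c [^] (k + l) = c [^] l \<otimes> c [^] k" using c by (simp add: nat_pow_mult add.commute)
  also have "\<dots> = c [^] l \<otimes> x \<otimes> u" using u mult c by (simp add: m_assoc)
  also have "c [^] l \<otimes> x = x \<otimes> c [^] l" using central_pow_commute[of c x l] c mult by simp
  also have "\<dots> \<otimes> u = x \<otimes> y \<otimes> (v \<otimes> u)" using u v mult c by (simp add: m_assoc)
  finally show ?case using u v by (metis dividesI m_closed)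
qed (use S in auto)

context finite_factorization_monoid
begin

text \<open>
  Complement \<open>a\<close> and \<open>b\<close> in a common central multiple, \<open>D = a' \<otimes> a = b' \<otimes> b\<close>. If \<open>d\<close> is the left-gcd of \<open>a'\<close> and
  \<open>b'\<close>, then \<open>m\<close> with \<open>D = d \<otimes> m\<close> is the left-lcm of \<open>a\<close> and \<open>b\<close>.
\<close>

lemma dual_left_lcm:
  assumes right_lcm: "\<And>a b. \<lbrakk>a \<in> carrier G; b \<in> carrier G\<rbrakk> \<Longrightarrow> \<exists>c\<in>carrier G. c lcmof a b"
    and c: "c \<in> carrier G" "\<And>x. x \<in> carrier G \<Longrightarrow> x \<otimes> c = c \<otimes> x"
    and bounded: "\<And>x. x \<in> carrier G \<Longrightarrow> \<exists>k::nat. x divides c [^] k"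
    and ab: "a \<in> carrier G" "b \<in> carrier G"
  shows "\<exists>m\<in>carrier G. is_left_lcm G m a b"
proof -
  have comm: "x \<otimes> c [^] k = c [^] k \<otimes> x" if "x \<in> carrier G" for x and k :: nat
    using central_pow_commute c that by simp
  have right_bounded: "\<exists>k::nat. \<exists>u\<in>carrier G. c [^] k = u \<otimes> x" if x: "x \<in> carrier G" for x
  proof -
    obtain k :: nat and u where u: "u \<in> carrier G" "c [^] k = x \<otimes> u"
      using bounded[OF x] by (auto simp: factor_def)
    then have "x \<otimes> (u \<otimes> x) = x \<otimes> c [^] k"
      using comm[OF x, of k] x by (simp flip: m_assoc)
    then have "u \<otimes> x = c [^] k" using u x c l_cancel by (metis m_closed nat_pow_closed)
    then show ?thesis using u by metis
  qed
  obtain i j :: nat and u v where u: "u \<in> carrier G" "c [^] i = u \<otimes> a"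
    and v: "v \<in> carrier G" "c [^] j = v \<otimes> b"
    using right_bounded ab by meson
  define D where "D = c [^] (i + j)"
  define a' where "a' = c [^] j \<otimes> u"
  define b' where "b' = c [^] i \<otimes> v"
  have a': "a' \<in> carrier G" "D = a' \<otimes> a" and b': "b' \<in> carrier G" "D = b' \<otimes> b"
    using u v ab c by (simp_all add: D_def a'_def b'_def m_assoc nat_pow_mult add.commute flip: u(2) v(2))
  obtain d where d: "d \<in> carrier G" "d gcdof a' b'"
    using left_gcd_exists[OF right_lcm a'(1) b'(1)] by blast
  then obtain a1 b1 where a1: "a1 \<in> carrier G" "a' = d \<otimes> a1" and b1: "b1 \<in> carrier G" "b' = d \<otimes> b1"
    by (auto simp: isgcd_def factor_def)
  define m where "m = a1 \<otimes> a"
  have m: "m \<in> carrier G" "D = d \<otimes> m" using a' a1 d ab by (simp_all add: m_def m_assoc)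
  have "d \<otimes> m = d \<otimes> (b1 \<otimes> b)" using m b' b1 d ab by (simp add: m_assoc)
  then have m_b: "m = b1 \<otimes> b" using l_cancel m d b1 ab by blast
  have "right_divides G m n"
    if n: "n \<in> carrier G" "right_divides G a n" "right_divides G b n" for n
  proof -
    obtain p q where p: "p \<in> carrier G" "n = p \<otimes> a" and q: "q \<in> carrier G" "n = q \<otimes> b"
      using n(2,3) by (auto simp: right_divides_def)
    \<comment> \<open>The competitor \<open>n\<close> may fail to divide \<open>D\<close>, so it is complemented in a larger multiple \<open>D \<otimes> E\<close>.\<close>
    obtain k :: nat and w where w: "w \<in> carrier G" "c [^] k = w \<otimes> n"
      using right_bounded n by blast
    define E where "E = c [^] k"
    have E: "E \<in> carrier G" "\<And>x. x \<in> carrier G \<Longrightarrow> x \<otimes> E = E \<otimes> x"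
      using c comm by (simp_all add: E_def)
    have D: "D \<in> carrier G" "\<And>x. x \<in> carrier G \<Longrightarrow> x \<otimes> D = D \<otimes> x"
      using c comm by (simp_all add: D_def)
    define w' where "w' = D \<otimes> w"
    have w': "w' \<in> carrier G" "w' \<otimes> n = D \<otimes> E"
      using w D(1) n(1) by (simp_all add: w'_def E_def m_assoc)
    have w'n: "w' \<otimes> n = E \<otimes> D" using w'(2) E(2)[OF D(1)] by simp
    have "w' \<otimes> p \<otimes> a = E \<otimes> a' \<otimes> a"
      using w'n w'(1) p ab a' E(1) by (simp add: m_assoc)
    then have wp: "w' \<otimes> p = E \<otimes> a'" using r_cancel w'(1) p(1) ab a'(1) E(1) by (meson m_closed)
    have "w' \<otimes> q \<otimes> b = E \<otimes> b' \<otimes> b"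
      using w'n w'(1) q ab b' E(1) by (simp add: m_assoc)
    then have wq: "w' \<otimes> q = E \<otimes> b'" using r_cancel w'(1) q(1) ab b'(1) E(1) by (meson m_closed)
    \<comment> \<open>The lcm of \<open>w'\<close> and \<open>E\<close> is \<open>E \<otimes> r\<close> with \<open>r\<close> a common divisor of \<open>a'\<close> and \<open>b'\<close>, which compares \<open>w'\<close> with \<open>E \<otimes> d\<close>.\<close>
    obtain l where l: "l \<in> carrier G" "l lcmof w' E"
      using right_lcm w'(1) E(1) by blast
    then obtain r where r: "r \<in> carrier G" "l = E \<otimes> r" using lcmofD(2)[OF l(2)] by (elim dividesE)
    have "l divides w' \<otimes> p"
      using l w'(1) p(1) E(1) dividesI'[OF wp a'(1)] by (intro lcmofD(3)[OF l(2)]) auto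
    moreover have "l divides w' \<otimes> q"
      using l w'(1) q(1) E(1) dividesI'[OF wq b'(1)] by (intro lcmofD(3)[OF l(2)]) auto
    ultimately have "l divides E \<otimes> a'" "l divides E \<otimes> b'"
      by (simp_all add: wp wq)
    then have "r divides a'" "r divides b'" using r E(1) a'(1) b'(1) by auto
    then have "r divides d" using d r by (auto simp: isgcd_def)
    then have "w' divides E \<otimes> d"
      using lcmofD(1)[OF l(2)] r E(1) w'(1) d(1) by (meson divides_mult_lI divides_trans)
    then obtain z where z: "z \<in> carrier G" "E \<otimes> d = w' \<otimes> z" by (elim dividesE)
    have "w' \<otimes> n = E \<otimes> D" by (fact w'n)
    also have "\<dots> = w' \<otimes> (z \<otimes> m)" using m z E(1) d(1) w'(1) by (simp flip: m_assoc)
    finally have "n = z \<otimes> m" using l_cancel[of w' n "z \<otimes> m"] w'(1) n(1) z(1) m(1) by blast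
    then show ?thesis using z by (auto simp: right_divides_def)
  qed
  moreover have "right_divides G a m" using a1 by (auto simp: right_divides_def m_def)
  moreover have "right_divides G b m" using b1 by (auto simp: right_divides_def m_b)
  ultimately show ?thesis using m by (auto simp: is_left_lcm_def)
qed

text \<open>
  For central \<open>c\<close>, left- and right-divisors agree since \<open>x \<otimes> y = c\<close> gives \<open>y \<otimes> x = c\<close>. The divisors of
  \<open>c\<close> generate because a divisor of \<open>c [^] Suc k\<close> is, by the greedy splitting, a divisor of \<open>c [^] k\<close>
  times a divisor of \<open>c\<close>.
\<close>

lemma central_garside_element:
  assumes right_lcm: "\<And>a b. \<lbrakk>a \<in> carrier G; b \<in> carrier G\<rbrakk> \<Longrightarrow> \<exists>c\<in>carrier G. c lcmof a b"
    and c: "c \<in> carrier G" "\<And>x. x \<in> carrier G \<Longrightarrow> x \<otimes> c = c \<otimes> x"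
    and bounded: "\<And>x. x \<in> carrier G \<Longrightarrow> \<exists>k::nat. x divides c [^] k"
  shows "garside_element G c"
proof -
  have swap: "y \<otimes> x = c" if "x \<in> carrier G" "y \<in> carrier G" "x \<otimes> y = c" for x y
  proof -
    have "x \<otimes> (y \<otimes> x) = x \<otimes> c" using that c by (simp flip: m_assoc)
    then show ?thesis using that c l_cancel by (meson m_closed)
  qed
  have eq: "left_divisors G c = right_divisors G c"
  proof -
    have "x divides c \<longleftrightarrow> right_divides G x c" if "x \<in> carrier G" for x
      unfolding factor_def right_divides_def using swap that by metis
    then show ?thesis by (auto simp: left_divisors_def right_divisors_def)
  qed
  have fin: "finite (left_divisors G c)"
    using finite_factorizations[OF c(1)] finite_factorizations_iff_left[OF c(1)] by simp
  have "(\<lambda>N. submonoid N G) hull left_divisors G c = carrier G"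
  proof (rule generatedI)
    fix N assume N: "submonoid N G" "left_divisors G c \<subseteq> N"
    have "x \<in> N" if "x \<in> carrier G" "x divides c [^] k" for x and k :: nat
      using that
    proof (induction k arbitrary: x)
      case 0
      then have "x = \<one>" using conical by (metis dividesE nat_pow_0)
      then show ?case using N submonoid.one_closed by metis
    next
      case (Suc k)
      obtain l where l: "l \<in> carrier G" "l lcmof x c" using right_lcm[OF Suc.prems(1) c(1)] by blast
      have "x divides c \<otimes> c [^] k" using Suc.prems(2) nat_pow_Suc2[OF c(1)] by simp
      then obtain y d where "y \<in> carrier G" "d \<in> carrier G" "x = y \<otimes> d" "y divides c [^] k"
        "right_divides G d c"
        using quasi_central_divisor_splits[OF c(1) Suc.prems(1) Suc.prems(1)
            nat_pow_closed[OF c(1)] l(1) c(2)[OF Suc.prems(1)] l(2)]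
        by blast
      moreover have "y \<in> N" using Suc.IH calculation by blast
      moreover have "d \<in> N" using N(2) eq calculation by (auto simp: right_divisors_def)
      ultimately show ?case using submonoid.m_closed[OF N(1)] by simp
    qed
    with bounded show "carrier G \<subseteq> N" by blast
  qed (auto simp: left_divisors_def)
  with c eq fin show ?thesis by (auto simp: garside_element_def)
qed

end

section \<open>Garside monoids seen from a root\<close>

text \<open>
  What the amalgamation needs to know about a factor and the root along which it is glued. A power of
  \<open>h\<close> is central, but \<open>h\<close> itself need not even be quasi-central.
\<close>

locale rooted_monoid = finite_factorization_monoid G for G (structure) +
  fixes h
  assumes root_closed [simp, intro]: "h \<in> carrier G"
    and root_neq_one: "h \<noteq> \<one>"
    and root_central: "\<exists>N::nat. 1 \<le> N \<and> (\<forall>x\<in>carrier G. x \<otimes> h [^] N = h [^] N \<otimes> x)"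
    and root_bounds: "x \<in> carrier G \<Longrightarrow> \<exists>k::nat. x divides h [^] k"
    and right_lcm: "\<lbrakk>a \<in> carrier G; b \<in> carrier G\<rbrakk> \<Longrightarrow> \<exists>c\<in>carrier G. c lcmof a b"

text \<open>
  The map \<open>\<sigma>\<close> with \<open>x \<otimes> g = g \<otimes> \<sigma> x\<close> is an injective endomorphism that permutes the divisors of \<open>g\<close>. As
  these generate, \<open>\<sigma>\<close> has finite order \<open>n\<close> and \<open>g [^] n\<close> is central. Finiteness passes from the divisors of
  \<open>g\<close> to those of its powers, since \<open>\<sigma>\<close> maps every divisor of \<open>g [^] Suc k\<close> to a divisor of \<open>g [^] k\<close> times a
  divisor of \<open>g\<close>.
\<close>

lemma (in garside_monoid) rooted_at_garside_root:
  assumes g: "garside_element M g" and root: "is_root M h g" and "h \<noteq> \<one>"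
  shows "rooted_monoid M h"
proof -
  define D where "D = left_divisors M g"
  have g_carr: "g \<in> carrier M" and D_right: "D = right_divisors M g" and fin_D: "finite D"
    and gen: "(\<lambda>N. submonoid N M) hull D = carrier M"
    using g unfolding garside_element_def D_def by blast+
  have D_carr: "D \<subseteq> carrier M" by (auto simp: D_def left_divisors_def)
  obtain q :: nat where h: "h \<in> carrier M" and q: "1 \<le> q" "h [^] q = g"
    using root by (auto simp: is_root_def)
  have "\<exists>x'. x' \<in> carrier M \<and> x \<otimes> g = g \<otimes> x'" if "x \<in> carrier M" for x
    using gen that
  proof (induction rule: hull_submonoid_induct)
    case (gen s)
    then obtain z where z: "z \<in> carrier M" "g = s \<otimes> z"
      unfolding D_def left_divisors_def factor_def by blast
    then have "z \<in> D" using gen by (auto simp: D_right right_divisors_def right_divides_def)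
    then obtain w where w: "w \<in> carrier M" "g = z \<otimes> w"
      unfolding D_def left_divisors_def factor_def by blast
    have "s \<otimes> g = s \<otimes> z \<otimes> w" using gen z(1) w(1) by (simp add: m_assoc flip: w(2))
    then have "s \<otimes> g = g \<otimes> w" using z(2) by simp
    with w show ?case by blast
  next
    case one then show ?case using g_carr by auto
  next
    case (mult x y)
    then obtain x' y' where "x' \<in> carrier M" "x \<otimes> g = g \<otimes> x'" "y' \<in> carrier M" "y \<otimes> g = g \<otimes> y'"
      by blast
    with mult g_carr have "x \<otimes> y \<otimes> g = g \<otimes> (x' \<otimes> y')" by (metis m_assoc)
    then show ?case using \<open>x' \<in> carrier M\<close> \<open>y' \<in> carrier M\<close> by blast
  qed
  then obtain \<sigma> where \<sigma>: "\<And>x. x \<in> carrier M \<Longrightarrow> \<sigma> x \<in> carrier M"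
    "\<And>x. x \<in> carrier M \<Longrightarrow> x \<otimes> g = g \<otimes> \<sigma> x"
    by metis
  have \<sigma>_eq: "\<sigma> x = y" if "x \<in> carrier M" "y \<in> carrier M" "x \<otimes> g = g \<otimes> y" for x y
    using that \<sigma> g_carr l_cancel by metis
  have \<sigma>_inj: "inj_on \<sigma> (carrier M)"
    using \<sigma> g_carr r_cancel by (metis inj_onI)
  have \<sigma>_one: "\<sigma> \<one> = \<one>" using g_carr by (intro \<sigma>_eq) auto
  have \<sigma>_mult: "\<sigma> (x \<otimes> y) = \<sigma> x \<otimes> \<sigma> y" if "x \<in> carrier M" "y \<in> carrier M" for x y
  proof (rule \<sigma>_eq)
    have "x \<otimes> y \<otimes> g = x \<otimes> g \<otimes> \<sigma> y"
      using that g_carr \<sigma>(1) by (simp add: m_assoc \<sigma>(2)[of y])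
    then show "x \<otimes> y \<otimes> g = g \<otimes> (\<sigma> x \<otimes> \<sigma> y)"
      using that g_carr \<sigma>(1) by (simp add: m_assoc \<sigma>(2)[of x])
  qed (use that \<sigma>(1) in auto)
  have \<sigma>_D: "\<sigma> s \<in> D" if "s \<in> D" for s
  proof -
    have s: "s \<in> carrier M" "s divides g" using that by (simp_all add: D_def left_divisors_def)
    from s(2) obtain z where z: "z \<in> carrier M" "g = s \<otimes> z" by (elim dividesE)
    have "s \<otimes> g = s \<otimes> z \<otimes> \<sigma> s" by (subst z(2)[symmetric]) (rule \<sigma>(2)[OF s(1)])
    then have "s \<otimes> g = s \<otimes> (z \<otimes> \<sigma> s)" using s(1) z(1) \<sigma>(1) by (simp add: m_assoc)
    then have "g = z \<otimes> \<sigma> s" using l_cancel[of s g "z \<otimes> \<sigma> s"] s(1) z(1) \<sigma>(1) g_carr by simp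
    then show ?thesis using z(1) \<sigma>(1)[OF s(1)] unfolding D_right right_divisors_def right_divides_def by blast
  qed
  \<comment> \<open>The permutation that \<open>\<sigma>\<close> induces on the finite set of divisors of \<open>g\<close> has finite order.\<close>
  define p where "p x = (if x \<in> D then \<sigma> x else x)" for x
  have "inj_on p D"
    using \<sigma>_inj D_carr by (auto simp: p_def inj_on_def subset_iff)
  moreover have "p ` D \<subseteq> D" using \<sigma>_D by (auto simp: p_def)
  ultimately have "bij_betw p D D"
    using fin_D by (simp add: bij_betw_def endo_inj_surj)
  then have "p permutes D" by (rule bij_imp_permutes) (simp add: p_def)
  then have "permutation p" using fin_D by (auto simp: permutation_permutes)
  then obtain n where n: "(p ^^ n) = id" "n > 0" by (rule permutation_is_nilpotent)
  have p_pow: "(p ^^ m) s = (\<sigma> ^^ m) s \<and> (\<sigma> ^^ m) s \<in> D" if "s \<in> D" for s m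
    using that \<sigma>_D by (induction m) (auto simp: p_def)
  have \<sigma>_pow: "(\<sigma> ^^ m) x \<in> carrier M" if "x \<in> carrier M" for x m
    using that \<sigma>(1) by (induction m) auto
  have \<sigma>_pow_mult: "(\<sigma> ^^ m) (x \<otimes> y) = (\<sigma> ^^ m) x \<otimes> (\<sigma> ^^ m) y"
    if "x \<in> carrier M" "y \<in> carrier M" for x y m
    using that \<sigma>_mult \<sigma>_pow by (induction m) auto
  have \<sigma>_pow_one: "(\<sigma> ^^ m) \<one> = \<one>" for m
    using \<sigma>_one by (induction m) auto
  have \<sigma>_n: "(\<sigma> ^^ n) x = x" if "x \<in> carrier M" for x
    using gen that
  proof (induction rule: hull_submonoid_induct)
    case (gen s) then show ?case using p_pow[of s n] n by simp
  qed (simp_all add: \<sigma>_pow_one \<sigma>_pow_mult)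
  have pow_shift: "x \<otimes> g [^] m = g [^] m \<otimes> (\<sigma> ^^ m) x" if "x \<in> carrier M" for x m
  proof (induction m)
    case (Suc m)
    have "x \<otimes> g [^] Suc m = g [^] m \<otimes> ((\<sigma> ^^ m) x \<otimes> g)"
      using Suc that g_carr \<sigma>_pow by (simp add: m_assoc[symmetric])
    also have "(\<sigma> ^^ m) x \<otimes> g = g \<otimes> (\<sigma> ^^ Suc m) x"
      using \<sigma>(2)[OF \<sigma>_pow[OF that]] by simp
    finally show ?case using that g_carr \<sigma>_pow[OF that, of "Suc m"] by (simp add: m_assoc del: funpow.simps)
  qed (use that in simp)
  define c where "c = g [^] n"
  have c: "c \<in> carrier M" "\<And>x. x \<in> carrier M \<Longrightarrow> x \<otimes> c = c \<otimes> x"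
    using pow_shift \<sigma>_n g_carr by (simp_all add: c_def)
  have c_root: "c = h [^] (q * n)" using q h by (auto simp: c_def nat_pow_pow)
  have "s divides c [^] (1::nat)" if "s \<in> D" for s
  proof -
    have "c = g \<otimes> g [^] (n - 1)"
      using n(2) g_carr nat_pow_Suc2[of g "n - 1"] by (simp add: c_def)
    moreover have "s divides g" "s \<in> carrier M" using that by (auto simp: D_def left_divisors_def)
    ultimately show ?thesis using g_carr c by (auto intro: divides_prod_r)
  qed
  then have bounded: "\<exists>k::nat. x divides c [^] k" if "x \<in> carrier M" for x
    using central_power_bounds[OF gen c _ that] by blast
  have lcm: "\<exists>l\<in>carrier M. l lcmof a b" if "a \<in> carrier M" "b \<in> carrier M" for a b
    using ex_right_lcm that .
  have fin_pow: "finite (left_divisors M (g [^] k))" for k :: nat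
  proof (induction k)
    case 0
    have "x = \<one>" if "x \<in> carrier M" "x divides \<one>" for x
      using that(2) by (rule dividesE) (metis conical that(1))
    then have "left_divisors M (g [^] (0::nat)) \<subseteq> {\<one>}"
      by (auto simp: left_divisors_def)
    then show ?case using finite_subset by blast
  next
    case (Suc k)
    have "\<sigma> ` left_divisors M (g [^] Suc k) \<subseteq> (\<lambda>(y, d). y \<otimes> d) ` (left_divisors M (g [^] k) \<times> D)"
    proof
      fix z assume "z \<in> \<sigma> ` left_divisors M (g [^] Suc k)"
      then obtain x where x: "x \<in> carrier M" "x divides g \<otimes> g [^] k" "z = \<sigma> x"
        using g_carr nat_pow_Suc2 by (auto simp: left_divisors_def)
      obtain l where l: "l \<in> carrier M" "l lcmof x g" using lcm x g_carr by blast
      obtain y d where "y \<in> carrier M" "d \<in> carrier M" "z = y \<otimes> d" "y divides g [^] k"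
        "right_divides M d g"
        using quasi_central_divisor_splits[OF g_carr x(1) \<sigma>(1)[OF x(1)] _ l(1) \<sigma>(2)[OF x(1)] l(2) x(2)]
          x(3) g_carr by blast
      then show "z \<in> (\<lambda>(y, d). y \<otimes> d) ` (left_divisors M (g [^] k) \<times> D)"
        unfolding D_right by (auto simp: left_divisors_def right_divisors_def)
    qed
    then have "finite (\<sigma> ` left_divisors M (g [^] Suc k))"
      using Suc fin_D by (meson finite_SigmaI finite_imageI finite_subset)
    moreover have "inj_on \<sigma> (left_divisors M (g [^] Suc k))"
      using \<sigma>_inj by (rule inj_on_subset) (auto simp: left_divisors_def)
    ultimately show ?case by (rule finite_imageD)
  qed
  have fin: "finite (left_divisors M a)" if a: "a \<in> carrier M" for a
  proof -
    obtain k :: nat where "a divides c [^] k" using bounded a by blast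
    then have "a divides g [^] (n * k)" using g_carr by (simp add: c_def nat_pow_pow)
    then have "left_divisors M a \<subseteq> left_divisors M (g [^] (n * k))"
      by (auto simp: left_divisors_def intro: divides_trans)
    then show ?thesis using fin_pow finite_subset by blast
  qed
  show ?thesis
  proof unfold_locales
    show "\<exists>N::nat. 1 \<le> N \<and> (\<forall>x\<in>carrier M. x \<otimes> h [^] N = h [^] N \<otimes> x)"
      using c(2) n(2) q(1) unfolding c_root by (intro exI[of _ "q * n"]) auto
    show "\<exists>k::nat. x divides h [^] k" if "x \<in> carrier M" for x
      using bounded[OF that] h by (auto simp: c_root nat_pow_pow)
    show "finite (factorizations a)" if "a \<in> carrier M" for a
      using fin[OF that] finite_factorizations_iff_left[OF that] by simp
    show "a = \<one> \<and> b = \<one>" if "a \<in> carrier M" "b \<in> carrier M" "a \<otimes> b = \<one>" for a b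
      by (rule conical[OF that])
    show "\<exists>l\<in>carrier M. l lcmof a b" if "a \<in> carrier M" "b \<in> carrier M" for a b
      by (rule lcm[OF that])
  qed fact+
qed

section \<open>Splitting off the root\<close>

context rooted_monoid
begin

lemma root_decomposition:
  assumes "y \<in> carrier G"
  shows "\<exists>k::nat. \<exists>t\<in>carrier G. \<not> h divides t \<and> y = h [^] k \<otimes> t"
  using assms
proof (induction "num_factorizations y" arbitrary: y rule: less_induct)
  case less
  show ?case
  proof (cases "h divides y")
    case False
    then show ?thesis using less.prems by (intro exI[of _ 0] bexI[of _ y]) auto
  next
    case True
    then obtain z where z: "z \<in> carrier G" "y = h \<otimes> z" by (elim dividesE)
    then have "num_factorizations z < num_factorizations y"
      using num_factorizations_less_right root_neq_one by simp
    then obtain k :: nat and t where t: "t \<in> carrier G" "\<not> h divides t" "z = h [^] k \<otimes> t"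
      using less.hyps z(1) by blast
    then have "y = h [^] Suc k \<otimes> t"
      unfolding z(2) t(3) nat_pow_Suc2[OF root_closed] by (simp add: m_assoc)
    then show ?thesis using t by blast
  qed
qed

lemma root_decomposition_unique:
  assumes "t \<in> carrier G" "\<not> h divides t" "t' \<in> carrier G" "\<not> h divides t'"
    and "h [^] (k::nat) \<otimes> t = h [^] k' \<otimes> t'"
  shows "k = k' \<and> t = t'"
proof -
  have *: "k = k' \<and> t = t'"
    if "k \<le> k'" "t \<in> carrier G" "\<not> h divides t" "t' \<in> carrier G"
      and eq: "h [^] k \<otimes> t = h [^] k' \<otimes> t'" for k k' :: nat and t t'
  proof -
    obtain j where j: "k' = k + j" using \<open>k \<le> k'\<close> le_Suc_ex by blast
    have "h [^] k \<otimes> t = h [^] k \<otimes> (h [^] j \<otimes> t')"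
      using eq that by (simp add: j m_assoc flip: nat_pow_mult)
    then have t: "t = h [^] j \<otimes> t'" using l_cancel[of "h [^] k" t] that by simp
    have "j = 0"
    proof (rule ccontr)
      assume "j \<noteq> 0"
      then obtain i where "j = Suc i" using not0_implies_Suc by blast
      then have "t = h \<otimes> (h [^] i \<otimes> t')"
        unfolding t using nat_pow_Suc2[OF root_closed] that by (simp add: m_assoc)
      with that show False by (metis dividesI m_closed nat_pow_closed root_closed)
    qed
    with t j that show ?thesis by simp
  qed
  show ?thesis
  proof (cases "k \<le> k'")
    case True then show ?thesis using *[of k k' t t'] assms by blast
  next
    case False
    then show ?thesis using *[of k' k t' t] assms by (metis nat_le_linear)
  qed
qed

lemma root_not_divides_one: "\<not> h divides \<one>"
  using conical root_neq_one by (metis dividesE root_closed)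

lemma root_power_inj: "h [^] (k::nat) = h [^] l \<Longrightarrow> k = l"
  using root_decomposition_unique[of \<one> \<one> k l] root_not_divides_one by simp

text \<open>
  A right-divisor of \<open>h [^] k\<close> whose root part has exponent at least \<open>k\<close> is \<open>h [^] k\<close> itself, for it would otherwise
  contain \<open>h [^] k\<close> as a proper middle factor. So the exponent drops at each proper right-divisor.
\<close>

lemma right_divisor_of_root_power:
  assumes "b \<in> carrier G" "t \<in> carrier G" and eq: "h [^] (k::nat) = b \<otimes> (h [^] (j::nat) \<otimes> t)"
    and "k \<le> j"
  shows "h [^] j \<otimes> t = h [^] k"
proof -
  obtain i where i: "j = k + i" using \<open>k \<le> j\<close> le_Suc_ex by blast
  have "b \<otimes> h [^] k \<otimes> (h [^] i \<otimes> t) = h [^] k"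
    using assms by (simp add: i m_assoc flip: nat_pow_mult)
  then have "h [^] i \<otimes> t = \<one>"
    using not_sandwiched(2)[of "h [^] k" b "h [^] i \<otimes> t"] assms by simp
  then show ?thesis using assms by (simp add: i m_assoc flip: nat_pow_mult)
qed

end

section \<open>Amalgams as free sets over both factors\<close>

text \<open>
  The factors \<open>A True\<close> and \<open>A False\<close> sit inside the monoid and share \<open>h\<close>; indexing them by a truth value lets one
  argument serve both. The set \<open>T i\<close> is a basis of the monoid as a left \<open>A i\<close>-set. The last
  assumption links the two bases: an element of \<open>A i\<close> that is free of \<open>h\<close> on the left can be pushed onto the
  tail, and the result is then a basis element for the other factor.
\<close>

locale free_amalgam = monoid M for M (structure) +
  fixes A T :: "bool \<Rightarrow> 'a set" and h :: 'a
  assumes factor_submonoid: "submonoid (A i) M"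
    and factor_rooted: "rooted_monoid (M\<lparr>carrier := A i\<rparr>) h"
    and factors_generate: "(\<lambda>N. submonoid N M) hull (A True \<union> A False) = carrier M"
    and tail_closed: "\<tau> \<in> T i \<Longrightarrow> \<tau> \<in> carrier M"
    and one_tail: "\<one> \<in> T i"
    and decomposition: "m \<in> carrier M \<Longrightarrow> \<exists>y\<in>A i. \<exists>\<tau>\<in>T i. m = y \<otimes> \<tau>"
    and decomposition_unique:
      "\<lbrakk>y \<in> A i; \<tau> \<in> T i; y' \<in> A i; \<tau>' \<in> T i; y \<otimes> \<tau> = y' \<otimes> \<tau>'\<rbrakk> \<Longrightarrow> y = y' \<and> \<tau> = \<tau>'"
    and push_tail: "\<lbrakk>t \<in> A i; t \<noteq> \<one>; \<not> h divides\<^bsub>M\<lparr>carrier := A i\<rparr>\<^esub> t; \<tau> \<in> T i\<rbrakk> \<Longrightarrow> t \<otimes> \<tau> \<in> T (\<not> i)"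
begin

abbreviation factor_monoid where "factor_monoid i \<equiv> M\<lparr>carrier := A i\<rparr>"

lemma factor_closed [simp, intro]: "a \<in> A i \<Longrightarrow> a \<in> carrier M"
  using factor_submonoid submonoid.mem_carrier by metis

lemma factor_mult [simp, intro]: "\<lbrakk>a \<in> A i; b \<in> A i\<rbrakk> \<Longrightarrow> a \<otimes> b \<in> A i"
  using factor_submonoid submonoid.m_closed by metis

lemma factor_one [simp, intro]: "\<one> \<in> A i"
  using factor_submonoid submonoid.one_closed by metis

lemma root_in_factor [simp, intro]: "h \<in> A i"
  using rooted_monoid.root_closed[OF factor_rooted[of i]] by simp

lemma root_carrier [simp, intro]: "h \<in> carrier M"
  using root_in_factor factor_closed by blast

lemma root_power_in_factor [simp, intro]: "h [^] (k::nat) \<in> A i"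
  by (induction k) auto

lemma factor_pow [simp]: "x [^]\<^bsub>factor_monoid i\<^esub> (k::nat) = x [^] k"
  by (simp add: nat_pow_def)

lemma carrier_induct [consumes 1, case_names factor one mult]:
  assumes "m \<in> carrier M" and "\<And>i a. a \<in> A i \<Longrightarrow> P a" and "P \<one>"
    and "\<And>x y. \<lbrakk>x \<in> carrier M; y \<in> carrier M; P x; P y\<rbrakk> \<Longrightarrow> P (x \<otimes> y)"
  shows "P m"
  using factors_generate assms(1) by (induction rule: hull_submonoid_induct) (use assms in auto)

text \<open>Since the action of the factor is free, dividing by an element of \<open>A i\<close> only affects the
  \<open>A i\<close>-component.\<close>

lemma factor_action:
  assumes "a \<in> A i" "m \<in> carrier M" "y \<in> A i" "\<tau> \<in> T i" and eq: "a \<otimes> m = y \<otimes> \<tau>"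
  shows "\<exists>y'\<in>A i. y = a \<otimes> y' \<and> m = y' \<otimes> \<tau>"
proof -
  obtain y' \<tau>' where y': "y' \<in> A i" "\<tau>' \<in> T i" "m = y' \<otimes> \<tau>'"
    using decomposition[OF assms(2)] by blast
  have "(a \<otimes> y') \<otimes> \<tau>' = y \<otimes> \<tau>"
    using eq assms(1) y' tail_closed[OF y'(2)] by (simp add: m_assoc)
  then have "a \<otimes> y' = y \<and> \<tau>' = \<tau>"
    using assms y' by (intro decomposition_unique) auto
  with y' show ?thesis by blast
qed

lemma left_cancel:
  assumes "a \<in> carrier M"
  shows "\<forall>m\<in>carrier M. \<forall>m'\<in>carrier M. a \<otimes> m = a \<otimes> m' \<longrightarrow> m = m'"
  using assms
proof (induction rule: carrier_induct)
  case (factor i a)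
  interpret A: rooted_monoid "factor_monoid i" h by (rule factor_rooted)
  show ?case
  proof (intro ballI impI)
    fix m m' assume m: "m \<in> carrier M" "m' \<in> carrier M" "a \<otimes> m = a \<otimes> m'"
    obtain y \<tau> where y: "y \<in> A i" "\<tau> \<in> T i" "m' = y \<otimes> \<tau>"
      using decomposition[OF m(2)] by blast
    have "a \<otimes> m = (a \<otimes> y) \<otimes> \<tau>" using m(3) y factor tail_closed[OF y(2)] by (simp add: m_assoc)
    then obtain y' where y': "y' \<in> A i" "a \<otimes> y = a \<otimes> y'" "m = y' \<otimes> \<tau>"
      using factor_action[OF factor m(1) factor_mult[OF factor y(1)] y(2)] by blast
    then have "y = y'" using A.l_cancel[of a y y'] factor y by simp
    with y y' show "m = m'" by simp
  qed
next
  case (mult x y)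
  show ?case
  proof (intro ballI impI)
    fix m m' assume m: "m \<in> carrier M" "m' \<in> carrier M" "x \<otimes> y \<otimes> m = x \<otimes> y \<otimes> m'"
    then have "x \<otimes> (y \<otimes> m) = x \<otimes> (y \<otimes> m')" using mult(1,2) by (simp add: m_assoc)
    then have "y \<otimes> m = y \<otimes> m'" using mult m by blast
    then show "m = m'" using mult(4) m by blast
  qed
qed auto

lemma amalgam_conical_left:
  assumes "a \<in> carrier M"
  shows "\<forall>m\<in>carrier M. a \<otimes> m = \<one> \<longrightarrow> a = \<one>"
  using assms
proof (induction rule: carrier_induct)
  case (factor i a)
  interpret A: rooted_monoid "factor_monoid i" h by (rule factor_rooted)
  show ?case
  proof (intro ballI impI)
    fix m assume m: "m \<in> carrier M" "a \<otimes> m = \<one>"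
    then obtain y' where "y' \<in> A i" "\<one> = a \<otimes> y'"
      using factor_action[OF factor m(1) factor_one one_tail] by auto
    then show "a = \<one>" using A.conical[of a y'] factor by simp
  qed
next
  case (mult x y)
  show ?case
  proof (intro ballI impI)
    fix m assume m: "m \<in> carrier M" "x \<otimes> y \<otimes> m = \<one>"
    then have "x \<otimes> (y \<otimes> m) = \<one>" using mult by (simp add: m_assoc)
    then have "x = \<one>" using mult m by blast
    moreover have "y = \<one>" using mult(2,4) m \<open>x = \<one>\<close> by auto
    ultimately show "x \<otimes> y = \<one>" by simp
  qed
qed auto

lemma amalgam_conical:
  assumes "a \<in> carrier M" "b \<in> carrier M" "a \<otimes> b = \<one>"
  shows "a = \<one> \<and> b = \<one>"
  using amalgam_conical_left assms by (metis l_one)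

text \<open>The product of the two exponents given by the factors works for both of them.\<close>

lemma ex_central_power:
  "\<exists>N::nat. 1 \<le> N \<and> (\<forall>x\<in>carrier M. x \<otimes> h [^] N = h [^] N \<otimes> x)"
proof -
  have "\<exists>N::nat. 1 \<le> N \<and> (\<forall>x\<in>A i. x \<otimes> h [^] N = h [^] N \<otimes> x)" for i
    using rooted_monoid.root_central[OF factor_rooted[of i]] by simp
  then obtain N where N: "\<And>i. 1 \<le> N i" "\<And>i x. x \<in> A i \<Longrightarrow> x \<otimes> h [^] (N i :: nat) = h [^] N i \<otimes> x"
    by metis
  define K where "K = N True * N False"
  have pow: "h [^] K = (h [^] N i) [^] N (\<not> i)" for i
    by (cases i) (simp_all add: K_def nat_pow_pow mult.commute)
  have "x \<otimes> h [^] K = h [^] K \<otimes> x" if "x \<in> carrier M" for x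
    using that
  proof (induction rule: carrier_induct)
    case (factor i a)
    then show ?case unfolding pow[of i] using N(2)[OF factor] factor by (intro central_pow_commute[of "h [^] N i"]) auto
  next
    case (mult x y)
    have "x \<otimes> y \<otimes> h [^] K = x \<otimes> (y \<otimes> h [^] K)" using mult(1,2) by (simp add: m_assoc)
    also have "\<dots> = x \<otimes> h [^] K \<otimes> y" using mult(1,2,4) by (simp add: m_assoc)
    also have "\<dots> = h [^] K \<otimes> (x \<otimes> y)" using mult(1,2,3) by (simp add: m_assoc)
    finally show ?case .
  qed simp
  moreover have "1 \<le> K" using N(1)[of True] N(1)[of False] by (simp add: K_def)
  ultimately show ?thesis by blast
qed

lemma factor_bounds:
  assumes "a \<in> A i"
  shows "\<exists>k::nat. a divides\<^bsub>factor_monoid i\<^esub> h [^] k"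
  using rooted_monoid.root_bounds[OF factor_rooted[of i], of a] assms by simp

lemma divides_in_amalgam: "a divides\<^bsub>factor_monoid i\<^esub> b \<Longrightarrow> a divides b"
  unfolding factor_def using factor_closed by force

lemma amalgam_bounded:
  assumes c: "c = h [^] (N::nat)" "1 \<le> N" "\<And>x. x \<in> carrier M \<Longrightarrow> x \<otimes> c = c \<otimes> x"
    and "x \<in> carrier M"
  shows "\<exists>k::nat. x divides c [^] k"
proof (rule central_power_bounds[OF factors_generate])
  fix s assume "s \<in> A True \<union> A False"
  then obtain i where s: "s \<in> A i" by blast
  then obtain k :: nat where k: "s divides h [^] k"
    using factor_bounds divides_in_amalgam by blast
  have "c [^] k = h [^] (k + (N - 1) * k)"
    using c by (simp add: nat_pow_pow flip: mult_Suc)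
  then have "c [^] k = h [^] k \<otimes> h [^] ((N - 1) * k)"
    by (simp add: nat_pow_mult)
  then have "s divides c [^] k"
    using divides_prod_r[OF k, of "h [^] ((N - 1) * k)"] s by auto
  then show "\<exists>k::nat. s divides c [^] k" ..
qed (use assms in auto)

text \<open>The factor \<open>x\<close> can be completed to a central element, which moves to the left, where it cancels.\<close>

lemma right_cancel:
  assumes carr: "a \<in> carrier M" "b \<in> carrier M" "x \<in> carrier M" and eq: "a \<otimes> x = b \<otimes> x"
  shows "a = b"
proof -
  obtain N :: nat where N: "1 \<le> N" "\<And>x. x \<in> carrier M \<Longrightarrow> x \<otimes> h [^] N = h [^] N \<otimes> x"
    using ex_central_power by blast
  define c where "c = h [^] N"
  have c: "c \<in> carrier M" "\<And>x. x \<in> carrier M \<Longrightarrow> x \<otimes> c = c \<otimes> x"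
    using N(2) by (simp_all add: c_def)
  obtain k :: nat where "x divides c [^] k"
    using amalgam_bounded[OF c_def N(1) c(2) carr(3)] by blast
  then obtain u where u: "u \<in> carrier M" "c [^] k = x \<otimes> u" by (elim dividesE)
  have "a \<otimes> c [^] k = a \<otimes> x \<otimes> u" using u carr by (simp add: m_assoc)
  also have "\<dots> = b \<otimes> x \<otimes> u" using eq by simp
  also have "\<dots> = b \<otimes> c [^] k" using u carr by (simp add: m_assoc)
  finally have "c [^] k \<otimes> a = c [^] k \<otimes> b"
    using central_pow_commute[OF c(1) carr(1) c(2)[OF carr(1)], of k]
      central_pow_commute[OF c(1) carr(2) c(2)[OF carr(2)], of k] by simp
  then show ?thesis using left_cancel[of "c [^] k"] carr c(1) by blast
qed

lemma amalgam_cancel: "monoid_cancel M"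
  using left_cancel right_cancel by (intro monoid_cancelI) blast+

subsection \<open>Finitely many divisors\<close>

lemma factorization_start:
  assumes "b \<in> carrier M"
  shows "b = \<one> \<or> (\<exists>i. \<exists>a\<in>A i. \<exists>b'\<in>carrier M. a \<noteq> \<one> \<and> b = a \<otimes> b')"
  using assms
proof (induction rule: carrier_induct)
  case (factor i a)
  then show ?case by (metis factor_closed one_closed r_one)
next
  case (mult x y)
  show ?case
  proof (cases "x = \<one>")
    case True with mult show ?thesis by simp
  next
    case False
    with mult obtain i a b' where "a \<in> A i" "b' \<in> carrier M" "a \<noteq> \<one>" "x = a \<otimes> b'" by blast
    with mult have "x \<otimes> y = a \<otimes> (b' \<otimes> y)" "b' \<otimes> y \<in> carrier M" by (simp_all add: m_assoc)
    with \<open>a \<in> A i\<close> \<open>a \<noteq> \<one>\<close> show ?thesis by blast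
  qed
qed simp

text \<open>
  The proper right-divisors are reached by stripping one nontrivial factor element first. For each
  side, only finitely many quotients arise in this first step, as the stripped element divides the
  \<open>A i\<close>-component.
\<close>

lemma finite_right_divisors_step:
  assumes m: "m \<in> carrier M"
    and step: "\<And>i a m'. \<lbrakk>a \<in> A i; a \<noteq> \<one>; m' \<in> carrier M; m = a \<otimes> m'\<rbrakk> \<Longrightarrow> finite (right_divisors M m')"
  shows "finite (right_divisors M m)"
proof -
  define S where "S i = {m' \<in> carrier M. \<exists>a\<in>A i. a \<noteq> \<one> \<and> m = a \<otimes> m'}" for i
  have fin_S: "finite (S i)" for i
  proof -
    interpret A: rooted_monoid "factor_monoid i" h by (rule factor_rooted)
    obtain y \<tau> where y: "y \<in> A i" "\<tau> \<in> T i" "m = y \<otimes> \<tau>" using decomposition[OF m] by blast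
    have "finite (right_divisors (factor_monoid i) y)"
      using A.finite_factorizations[of y] A.finite_factorizations_iff_right[of y] y by simp
    moreover have "S i \<subseteq> (\<lambda>y'. y' \<otimes> \<tau>) ` right_divisors (factor_monoid i) y"
    proof
      fix m' assume "m' \<in> S i"
      then obtain a where a: "a \<in> A i" "m = a \<otimes> m'" and m': "m' \<in> carrier M" by (auto simp: S_def)
      then obtain y' where "y' \<in> A i" "y = a \<otimes> y'" "m' = y' \<otimes> \<tau>"
        using factor_action[of a i m' y \<tau>] y by auto
      with a show "m' \<in> (\<lambda>y'. y' \<otimes> \<tau>) ` right_divisors (factor_monoid i) y"
        unfolding right_divisors_def right_divides_def by auto
    qed
    ultimately show ?thesis by (meson finite_imageI finite_subset)
  qed
  have "right_divisors M m \<subseteq> insert m (\<Union>i. \<Union>m'\<in>S i. right_divisors M m')"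
  proof
    fix c assume "c \<in> right_divisors M m"
    then obtain b where b: "b \<in> carrier M" "m = b \<otimes> c" and c: "c \<in> carrier M"
      by (auto simp: right_divisors_def right_divides_def)
    show "c \<in> insert m (\<Union>i. \<Union>m'\<in>S i. right_divisors M m')"
    proof (cases "b = \<one>")
      case True with b c show ?thesis by simp
    next
      case False
      then obtain i a b' where a: "a \<in> A i" "b' \<in> carrier M" "a \<noteq> \<one>" "b = a \<otimes> b'"
        using factorization_start[OF b(1)] by blast
      then have "m = a \<otimes> (b' \<otimes> c)" using b c by (simp add: m_assoc)
      with a c have "b' \<otimes> c \<in> S i" by (auto simp: S_def)
      moreover have "c \<in> right_divisors M (b' \<otimes> c)"
        using a c by (auto simp: right_divisors_def right_divides_def)
      ultimately show ?thesis by blast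
    qed
  qed
  moreover have "finite (\<Union>i. \<Union>m'\<in>S i. right_divisors M m')"
    using fin_S step by (intro finite_UN_I) (auto simp: S_def)
  ultimately show ?thesis by (meson finite_insert finite_subset)
qed

text \<open>
  This controls what can happen above a tail \<open>\<tau>\<close> when elements are stripped from
  \<open>h [^] k \<otimes> \<tau>\<close>. Let the proper right-divisor \<open>y\<close> of \<open>h [^] k\<close> be \<open>h [^] j \<otimes> t\<close> with \<open>j < k\<close> and \<open>h\<close> not
  dividing \<open>t\<close>. Stripping in \<open>A i\<close> replaces \<open>y\<close> by a proper right-divisor, which the inner induction covers.
  Stripping in the other factor sees only \<open>h [^] j\<close> above the longer tail \<open>t \<otimes> \<tau>\<close>; the outer
  induction applies, because each \<open>h [^] l \<otimes> t\<close> with \<open>l < j\<close> is a proper right-divisor of \<open>y\<close>. If \<open>t\<close> is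
  trivial, then \<open>y = h [^] j\<close> and the hypothesis on smaller powers above \<open>\<tau>\<close> takes over.
\<close>

lemma finite_right_divisors_above_tail:
  assumes "\<tau> \<in> T i" and "\<And>l. l < k \<Longrightarrow> finite (right_divisors M (h [^] (l::nat) \<otimes> \<tau>))"
    and "y \<in> A i" "b \<in> A i" "h [^] k = b \<otimes> y" "y \<noteq> h [^] k"
  shows "finite (right_divisors M (y \<otimes> \<tau>))"
  using assms
proof (induction k arbitrary: i \<tau> y b rule: less_induct)
  case (less k)
  interpret A: rooted_monoid "factor_monoid i" h by (rule factor_rooted)
  from less.prems(3-6) show ?case
  proof (induction "A.num_factorizations y" arbitrary: y b rule: less_induct)
    case inner: (less y)
    note prems = less.prems(1,2) inner.prems
    obtain j :: nat and t where t: "t \<in> A i" "\<not> h divides\<^bsub>factor_monoid i\<^esub> t" "y = h [^] j \<otimes> t"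
      using A.root_decomposition[of y] prems by auto
    have "j < k"
      using A.right_divisor_of_root_power[of b t k j] prems t by (simp, metis not_less)
    show ?case
    proof (cases "t = \<one>")
      case True
      then show ?thesis using prems(2)[OF \<open>j < k\<close>] t by simp
    next
      case False
      then have tail: "t \<otimes> \<tau> \<in> T (\<not> i)" using push_tail t prems(1) by blast
      have lower: "finite (right_divisors M (y' \<otimes> \<tau>))"
        if y': "y' \<in> A i" "a \<in> A i" "a \<noteq> \<one>" "y = a \<otimes> y'" for y' a
      proof (rule inner.hyps)
        show less_y: "A.num_factorizations y' < A.num_factorizations y"
          using A.num_factorizations_less_right[of a y'] y' by simp
        show "y' \<in> A i" "b \<otimes> a \<in> A i" using y' prems by auto
        show "h [^] k = b \<otimes> a \<otimes> y'" using y' prems(4,5) by (simp add: m_assoc)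
        have "A.num_factorizations y \<le> A.num_factorizations (h [^] k)"
          using A.num_factorizations_le_right[of b y] prems by simp
        with less_y show "y' \<noteq> h [^] k" by auto
      qed
      show ?thesis
      proof (rule finite_right_divisors_step)
        show "y \<otimes> \<tau> \<in> carrier M" using prems tail_closed by auto
        fix i' a m' assume a: "a \<in> A i'" "a \<noteq> \<one>" "m' \<in> carrier M" "y \<otimes> \<tau> = a \<otimes> m'"
        show "finite (right_divisors M m')"
        proof (cases "i' = i")
          case True
          then obtain y' where "y' \<in> A i" "y = a \<otimes> y'" "m' = y' \<otimes> \<tau>"
            using factor_action[of a i m' y \<tau>] a prems by auto
          with lower a True show ?thesis by auto
        next
          case False
          then have i': "i' = (\<not> i)" by auto
          have "a \<otimes> m' = h [^] j \<otimes> (t \<otimes> \<tau>)"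
            using a(4) t tail_closed[OF prems(1)] by (simp add: m_assoc)
          then obtain z where z: "z \<in> A i'" "h [^] j = a \<otimes> z" "m' = z \<otimes> (t \<otimes> \<tau>)"
            using factor_action[of a i' m' "h [^] j" "t \<otimes> \<tau>"] a tail i' by auto
          have "finite (right_divisors M (z \<otimes> (t \<otimes> \<tau>)))"
          proof (rule less.IH[OF \<open>j < k\<close>])
            show "t \<otimes> \<tau> \<in> T i'" using tail i' by simp
            show "z \<in> A i'" "a \<in> A i'" "h [^] j = a \<otimes> z" using z a by auto
            interpret B: rooted_monoid "factor_monoid i'" h by (rule factor_rooted)
            have "B.num_factorizations z < B.num_factorizations (h [^] j)"
              using B.num_factorizations_less_right[of a z] a z by simp
            then show "z \<noteq> h [^] j" by auto
            fix l assume "l < j"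
            then have "0 < j - l" "j = (j - l) + l" by simp_all
            then have hj: "h [^] j = h [^] (j - l) \<otimes> h [^] l"
              by (simp add: nat_pow_mult)
            have "h [^] (j - l) \<noteq> \<one>"
              using A.root_power_inj[of "j - l" 0] \<open>0 < j - l\<close> by auto
            moreover have "y = h [^] (j - l) \<otimes> (h [^] l \<otimes> t)"
              using t hj by (simp add: m_assoc)
            ultimately have "finite (right_divisors M ((h [^] l \<otimes> t) \<otimes> \<tau>))"
              using t by (intro lower[of _ "h [^] (j - l)"]) auto
            then show "finite (right_divisors M (h [^] l \<otimes> (t \<otimes> \<tau>)))"
              using t tail_closed[OF prems(1)] by (simp add: m_assoc)
          qed
          then show ?thesis using z by simp
        qed
      qed
    qed
  qed
qed

lemma finite_right_divisors_root_power: "finite (right_divisors M (h [^] (k::nat)))"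
proof (induction k rule: less_induct)
  case (less k)
  show ?case
  proof (rule finite_right_divisors_step)
    fix i a m' assume a: "a \<in> A i" "a \<noteq> \<one>" "m' \<in> carrier M" "h [^] k = a \<otimes> m'"
    interpret A: rooted_monoid "factor_monoid i" h by (rule factor_rooted)
    have "a \<otimes> m' = h [^] k \<otimes> \<one>" unfolding a(4)[symmetric] by simp
    then obtain y where y: "y \<in> A i" "h [^] k = a \<otimes> y" "m' = y \<otimes> \<one>"
      using factor_action[OF a(1,3) root_power_in_factor one_tail] by blast
    have "A.num_factorizations y < A.num_factorizations (h [^] k)"
      using A.num_factorizations_less_right[of a y] a(1,2) y(1,2) by simp
    then have "y \<noteq> h [^] k" by auto
    then show "finite (right_divisors M m')"
      unfolding y(3) using less
      by (intro finite_right_divisors_above_tail[OF one_tail _ y(1) a(1) y(2)]) simp_all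
  qed simp
qed

lemma amalgam_finite_factorization: "finite_factorization_monoid M"
proof -
  interpret monoid_cancel M by (rule amalgam_cancel)
  obtain N :: nat where N: "1 \<le> N" "\<And>x. x \<in> carrier M \<Longrightarrow> x \<otimes> h [^] N = h [^] N \<otimes> x"
    using ex_central_power by blast
  have "finite (left_divisors M a)" if a: "a \<in> carrier M" for a
  proof -
    obtain k :: nat where "a divides (h [^] N) [^] k"
      using amalgam_bounded[OF HOL.refl N a] by blast
    then have "a divides h [^] (N * k)" by (simp add: nat_pow_pow)
    then have "left_divisors M a \<subseteq> left_divisors M (h [^] (N * k))"
      by (auto simp: left_divisors_def intro: divides_trans)
    moreover have "finite (left_divisors M (h [^] (N * k)))"
      using finite_right_divisors_root_power[of "N * k"] finite_factorizations_iff_left[of "h [^] (N * k)"]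
        finite_factorizations_iff_right[of "h [^] (N * k)"] by simp
    ultimately show ?thesis by (rule finite_subset)
  qed
  then have "finite (factorizations a)" if "a \<in> carrier M" for a
    using finite_factorizations_iff_left that by blast
  then show ?thesis
    by (intro finite_factorization_monoid.intro finite_factorization_monoid_axioms.intro
        amalgam_cancel amalgam_conical)
qed

subsection \<open>Lcms\<close>

lemma factor_lcm_in_amalgam:
  assumes l: "l lcmof\<^bsub>factor_monoid i\<^esub> a b" and ab: "a \<in> A i" "b \<in> A i" "l \<in> A i"
  shows "l lcmof a b"
proof (rule lcmofI)
  show "a divides l" "b divides l"
    using lcmofD(1,2)[OF l] by (auto intro: divides_in_amalgam)
  fix m assume m: "m \<in> carrier M" "a divides m" "b divides m"
  obtain y \<tau> where y: "y \<in> A i" "\<tau> \<in> T i" "m = y \<otimes> \<tau>" using decomposition[OF m(1)] by blast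
  have *: "x divides\<^bsub>factor_monoid i\<^esub> y" if x: "x \<in> A i" "x divides m" for x
  proof -
    obtain u where "u \<in> carrier M" "m = x \<otimes> u" using x(2) by (elim dividesE)
    then obtain y' where "y' \<in> A i" "y = x \<otimes> y'"
      using factor_action[of x i u y \<tau>] x y by auto
    then show ?thesis by (auto simp: factor_def)
  qed
  have "l divides\<^bsub>factor_monoid i\<^esub> y"
    using * ab m y by (intro lcmofD(3)[OF l]) auto
  then have "l divides y" by (rule divides_in_amalgam)
  then show "l divides m"
    using divides_prod_r[of l y \<tau>] y ab tail_closed by auto
qed

lemma normal_form_root_power:
  assumes "m \<in> carrier M"
  shows "\<exists>i. \<exists>k::nat. \<exists>\<tau>\<in>T i. m = h [^] k \<otimes> \<tau>"
proof -
  interpret A: rooted_monoid "factor_monoid True" h by (rule factor_rooted)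
  obtain y \<tau> where y: "y \<in> A True" "\<tau> \<in> T True" "m = y \<otimes> \<tau>" using decomposition[OF assms] by blast
  obtain k :: nat and t where t: "t \<in> A True" "\<not> h divides\<^bsub>factor_monoid True\<^esub> t" "y = h [^] k \<otimes> t"
    using A.root_decomposition[of y] y by auto
  show ?thesis
  proof (cases "t = \<one>")
    case True
    with t y have "m = h [^] k \<otimes> \<tau>" by simp
    with y show ?thesis by blast
  next
    case False
    then have "t \<otimes> \<tau> \<in> T (\<not> True)" using push_tail t y by blast
    moreover have "m = h [^] k \<otimes> (t \<otimes> \<tau>)" using t y tail_closed[OF y(2)] by (simp add: m_assoc)
    ultimately show ?thesis by blast
  qed
qed

text \<open>
  A common multiple \<open>m\<close> of \<open>a\<close> and \<open>b\<close> has the form \<open>h [^] k \<otimes> \<tau>\<close> with a tail \<open>\<tau>\<close> for one of the factors. If that is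
  the factor of \<open>a\<close>, then \<open>a\<close> divides \<open>h [^] k\<close>, so \<open>p \<le> k\<close>; otherwise \<open>b\<close> divides \<open>h [^] k\<close>, so
  \<open>p \<le> q \<le> k\<close>. In both cases \<open>m\<close> is a multiple of \<open>h [^] p\<close>, and so \<open>a\<close> may be replaced by
  \<open>h [^] p\<close>, which lies in the factor of \<open>b\<close>.
\<close>

lemma mixed_lcm:
  assumes a: "a \<in> A i" and b: "b \<in> A (\<not> i)"
    and p: "a divides\<^bsub>factor_monoid i\<^esub> h [^] p" "\<And>k::nat. a divides\<^bsub>factor_monoid i\<^esub> h [^] k \<Longrightarrow> p \<le> k"
    and q: "\<And>k::nat. b divides\<^bsub>factor_monoid (\<not> i)\<^esub> h [^] k \<Longrightarrow> q \<le> k"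
    and "p \<le> (q::nat)"
  shows "\<exists>l\<in>carrier M. l lcmof a b"
proof -
  interpret B: rooted_monoid "factor_monoid (\<not> i)" h by (rule factor_rooted)
  obtain l where l: "l \<in> A (\<not> i)" "l lcmof\<^bsub>factor_monoid (\<not> i)\<^esub> (h [^] p) b"
    using B.right_lcm[of "h [^] p" b] b by auto
  then have lcm: "l lcmof (h [^] p) b" using factor_lcm_in_amalgam b by blast
  have "l lcmof a b"
  proof (rule lcmofI)
    show "b divides l" using lcm by (rule lcmofD)
    show "a divides l"
      using divides_in_amalgam[OF p(1)] lcmofD(1)[OF lcm] a by (auto intro: divides_trans)
    fix m assume m: "m \<in> carrier M" "a divides m" "b divides m"
    obtain i' and k :: nat and \<tau> where \<tau>: "\<tau> \<in> T i'" "m = h [^] k \<otimes> \<tau>"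
      using normal_form_root_power[OF m(1)] by blast
    have *: "x divides\<^bsub>factor_monoid i'\<^esub> h [^] k" if x: "x \<in> A i'" "x divides m" for x
    proof -
      obtain u where "u \<in> carrier M" "m = x \<otimes> u" using x(2) by (elim dividesE)
      then obtain y' where "y' \<in> A i'" "h [^] k = x \<otimes> y'"
        using factor_action[of x i' u "h [^] k" \<tau>] x \<tau> by auto
      then show ?thesis by (auto simp: factor_def)
    qed
    have "p \<le> k"
    proof (cases "i' = i")
      case True then show ?thesis using * p(2) a m by blast
    next
      case False
      then have i': "i' = (\<not> i)" by auto
      then have "b divides\<^bsub>factor_monoid i'\<^esub> h [^] k" using *[of b] b m(3) by blast
      then have "q \<le> k" using q unfolding i' by blast
      then show ?thesis using \<open>p \<le> q\<close> by simp
    qed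
    then have "h [^] k = h [^] p \<otimes> h [^] (k - p)" by (simp add: nat_pow_mult)
    then have "m = h [^] p \<otimes> (h [^] (k - p) \<otimes> \<tau>)"
      using \<tau> tail_closed[OF \<tau>(1)] by (simp add: m_assoc)
    then have "h [^] p divides m" by (rule dividesI') (simp add: tail_closed[OF \<tau>(1)])
    with m show "l divides m" by (intro lcmofD(3)[OF lcm])
  qed
  with l show ?thesis by blast
qed

lemma factor_elements_lcm:
  assumes "a \<in> A i" "b \<in> A j"
  shows "\<exists>l\<in>carrier M. l lcmof a b"
proof (cases "i = j")
  case True
  interpret A: rooted_monoid "factor_monoid i" h by (rule factor_rooted)
  obtain l where "l \<in> A i" "l lcmof\<^bsub>factor_monoid i\<^esub> a b"
    using A.right_lcm[of a b] assms True by auto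
  then show ?thesis using factor_lcm_in_amalgam assms True by blast
next
  case False
  then have j: "j = (\<not> i)" and i: "i = (\<not> j)" by auto
  define p where "p = (LEAST k::nat. a divides\<^bsub>factor_monoid i\<^esub> h [^] k)"
  define q where "q = (LEAST k::nat. b divides\<^bsub>factor_monoid j\<^esub> h [^] k)"
  have p: "a divides\<^bsub>factor_monoid i\<^esub> h [^] p" "\<And>k::nat. a divides\<^bsub>factor_monoid i\<^esub> h [^] k \<Longrightarrow> p \<le> k"
    unfolding p_def using LeastI_ex[OF factor_bounds[OF assms(1)]] by (auto intro: Least_le)
  have q: "b divides\<^bsub>factor_monoid j\<^esub> h [^] q" "\<And>k::nat. b divides\<^bsub>factor_monoid j\<^esub> h [^] k \<Longrightarrow> q \<le> k"
    unfolding q_def using LeastI_ex[OF factor_bounds[OF assms(2)]] by (auto intro: Least_le)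
  show ?thesis
  proof (cases "p \<le> q")
    case True
    show ?thesis
      using mixed_lcm[of a i b p q] assms p q True unfolding j by blast
  next
    case False
    then have "\<exists>l\<in>carrier M. l lcmof b a"
      using mixed_lcm[of b j a q p] assms p q unfolding i by auto
    then obtain l where "l \<in> carrier M" "l lcmof b a" ..
    then show ?thesis using lcmof_commute[of M l b a] by blast
  qed
qed

theorem amalgam_garside: "garside_monoid M"
proof -
  interpret finite_factorization_monoid M by (rule amalgam_finite_factorization)
  obtain N :: nat where N: "1 \<le> N" "\<And>x. x \<in> carrier M \<Longrightarrow> x \<otimes> h [^] N = h [^] N \<otimes> x"
    using ex_central_power by blast
  define c where "c = h [^] N"
  have c: "c \<in> carrier M" "\<And>x. x \<in> carrier M \<Longrightarrow> x \<otimes> c = c \<otimes> x"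
    using N(2) by (simp_all add: c_def)
  have bounded: "\<exists>k::nat. x divides c [^] k" if "x \<in> carrier M" for x
    using amalgam_bounded[OF c_def N(1) c(2) that] by blast
  have lcm: "\<exists>l\<in>carrier M. l lcmof a b" if ab: "a \<in> carrier M" "b \<in> carrier M" for a b
  proof -
    obtain k l :: nat and u v where u: "u \<in> carrier M" "c [^] k = a \<otimes> u"
      and v: "v \<in> carrier M" "c [^] l = b \<otimes> v"
      using bounded ab by (metis dividesE)
    have "c [^] (k + l) = a \<otimes> (u \<otimes> c [^] l)" "c [^] (k + l) = b \<otimes> (v \<otimes> c [^] k)"
      using u v ab c(1) by (simp_all add: m_assoc[symmetric] nat_pow_mult add.commute flip: u(2) v(2))
    then have dvd: "a divides c [^] (k + l)" "b divides c [^] (k + l)"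
      using u v c(1) by (metis dividesI m_closed nat_pow_closed)+
    show ?thesis
    proof (rule right_lcm_from_generators[OF factors_generate _ nat_pow_closed[OF c(1)] ab dvd])
      fix x y assume "x \<in> A True \<union> A False" "y \<in> A True \<union> A False"
      then show "\<exists>l\<in>carrier M. l lcmof x y" using factor_elements_lcm by blast
    qed
  qed
  show ?thesis
  proof unfold_locales
    show "\<exists>m\<in>carrier M. is_left_lcm M m a b" if "a \<in> carrier M" "b \<in> carrier M" for a b
      by (rule dual_left_lcm[OF lcm c bounded that])
    show "\<exists>g. garside_element M g"
      using central_garside_element[OF lcm c bounded] by blast
    show "a = \<one> \<and> b = \<one>" if "a \<in> carrier M" "b \<in> carrier M" "a \<otimes> b = \<one>" for a b
      by (rule conical[OF that])
    show "\<exists>l\<in>carrier M. l lcmof a b" if "a \<in> carrier M" "b \<in> carrier M" for a b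
      by (rule lcm[OF that])
  qed
qed

end

section \<open>Quotients and the presentation of the amalgam\<close>

context monoid
begin

lemma generated_cong_carrier:
  "(x, y) \<in> generated_cong G R \<Longrightarrow> x \<in> carrier G \<and> y \<in> carrier G"
  by (induction rule: generated_cong.induct) auto

lemma equiv_generated_cong: "equiv (carrier G) (generated_cong G R)"
proof (rule equivI)
  show "generated_cong G R \<subseteq> carrier G \<times> carrier G"
    using generated_cong_carrier by auto
  show "refl_on (carrier G) (generated_cong G R)"
    by (auto simp: refl_on_def intro: generated_cong.refl)
  show "sym (generated_cong G R)" by (auto simp: sym_def intro: generated_cong.sym)
  show "trans (generated_cong G R)" by (auto simp: trans_def intro: generated_cong.trans)
qed

lemma cong_class_eq_iff:
  assumes "x \<in> carrier G" "y \<in> carrier G"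
  shows "cong_class G R x = cong_class G R y \<longleftrightarrow> (x, y) \<in> generated_cong G R"
  unfolding cong_class_def using eq_equiv_class_iff[OF equiv_generated_cong assms] .

lemma mem_cong_class: "x \<in> carrier G \<Longrightarrow> x \<in> cong_class G R x"
  by (simp add: cong_class_def generated_cong.refl)

lemma quotient_carrier: "carrier (quotient_monoid G R) = cong_class G R ` carrier G"
  by (auto simp: quotient_monoid_def quotient_def cong_class_def)

lemma quotient_mult:
  assumes "x \<in> carrier G" "y \<in> carrier G"
  shows "cong_class G R x \<otimes>\<^bsub>quotient_monoid G R\<^esub> cong_class G R y = cong_class G R (x \<otimes> y)"
proof -
  let ?E = "generated_cong G R"
  have "(x \<otimes> y, z) \<in> ?E" if "(x, a) \<in> ?E" "(y, b) \<in> ?E" "(a \<otimes> b, z) \<in> ?E" for a b z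
    using generated_cong.mult[OF that(1,2)] that(3) by (rule generated_cong.trans)
  moreover have "(x, x) \<in> ?E" "(y, y) \<in> ?E"
    using assms by (auto intro: generated_cong.refl)
  ultimately show ?thesis
    by (auto simp: quotient_monoid_def cong_class_def)
qed

lemma quotient_one: "\<one>\<^bsub>quotient_monoid G R\<^esub> = cong_class G R \<one>"
  by (simp add: quotient_monoid_def)

lemma quotient_is_monoid: "monoid (quotient_monoid G R)"
  by (rule monoidI) (auto simp: quotient_carrier quotient_mult quotient_one m_assoc)

lemma cong_class_hom: "cong_class G R \<in> hom G (quotient_monoid G R)"
  by (rule homI) (auto simp: quotient_carrier quotient_mult)

lemma cong_class_relation:
  assumes "(x, y) \<in> R" "x \<in> carrier G" "y \<in> carrier G"
  shows "cong_class G R x = cong_class G R y"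
  using assms by (simp add: cong_class_eq_iff generated_cong.base)

lemma quotient_universal:
  assumes f: "f \<in> hom G P"
    and R: "\<And>x y. \<lbrakk>(x, y) \<in> R; x \<in> carrier G; y \<in> carrier G\<rbrakk> \<Longrightarrow> f x = f y"
  shows "\<exists>F\<in>hom (quotient_monoid G R) P. \<forall>x\<in>carrier G. F (cong_class G R x) = f x"
proof -
  have f_cong: "f x = f y" if "(x, y) \<in> generated_cong G R" for x y
    using that
  proof (induction rule: generated_cong.induct)
    case (mult x x' y y')
    then have "x \<in> carrier G" "x' \<in> carrier G" "y \<in> carrier G" "y' \<in> carrier G"
      using generated_cong_carrier by blast+
    with mult show ?case using f by (simp add: hom_mult)
  qed (use R in auto)
  define F where "F C = f (SOME x. x \<in> C)" for C
  have F: "F (cong_class G R x) = f x" if "x \<in> carrier G" for x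
  proof -
    have "(SOME z. z \<in> cong_class G R x) \<in> cong_class G R x"
      using mem_cong_class[OF that] by (rule someI)
    then show ?thesis unfolding F_def by (metis Image_singleton_iff cong_class_def f_cong)
  qed
  have "F \<in> hom (quotient_monoid G R) P"
  proof (rule homI)
    fix C D assume "C \<in> carrier (quotient_monoid G R)" "D \<in> carrier (quotient_monoid G R)"
    then obtain x y where "x \<in> carrier G" "C = cong_class G R x" "y \<in> carrier G" "D = cong_class G R y"
      by (auto simp: quotient_carrier)
    then show "F (C \<otimes>\<^bsub>quotient_monoid G R\<^esub> D) = F C \<otimes>\<^bsub>P\<^esub> F D"
      using f by (simp add: quotient_mult F hom_mult)
  qed (use f in \<open>auto simp: quotient_carrier F hom_in_carrier\<close>)
  with F show ?thesis by blast
qed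

lemma generators_image:
  assumes gen: "(\<lambda>N. submonoid N G) hull S = carrier G"
    and Q: "monoid Q" and f: "f \<in> hom G Q" "f \<one> = \<one>\<^bsub>Q\<^esub>" "f ` carrier G = carrier Q"
  shows "(\<lambda>N. submonoid N Q) hull (f ` S) = carrier Q"
proof (rule monoid.generatedI[OF Q])
  show "f ` S \<subseteq> carrier Q" using gen hull_subset f(3) by (metis image_mono)
  fix N assume N: "submonoid N Q" "f ` S \<subseteq> N"
  have "f x \<in> N" if "x \<in> carrier G" for x
    using gen that
  proof (induction rule: hull_submonoid_induct)
    case one then show ?case using f(2) submonoid.one_closed[OF N(1)] by simp
  next
    case (mult x y)
    then show ?case using hom_mult[OF f(1)] submonoid.m_closed[OF N(1)] by simp
  qed (use N in auto)
  then show "carrier Q \<subseteq> N" by (auto simp flip: f(3))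
qed

lemma hom_pow:
  assumes "monoid P" "f \<in> hom G P" "f \<one> = \<one>\<^bsub>P\<^esub>" "x \<in> carrier G"
  shows "f (x [^] (k::nat)) = f x [^]\<^bsub>P\<^esub> k"
  using assms by (induction k) (auto simp: hom_mult)

end

lemma free_monoid_is_monoid: "monoid (free_monoid S)"
  by (rule monoidI) (auto simp: free_monoid_def)

lemma free_monoid_generators:
  "(\<lambda>N. submonoid N (free_monoid S)) hull ((\<lambda>s. [s]) ` S) = carrier (free_monoid S)"
proof (rule monoid.generatedI[OF free_monoid_is_monoid])
  fix N assume N: "submonoid N (free_monoid S)" "(\<lambda>s. [s]) ` S \<subseteq> N"
  have "w \<in> N" if "w \<in> lists S" for w
    using that
  proof (induction w)
    case Nil
    then show ?case using submonoid.one_closed[OF N(1)] by (simp add: free_monoid_def)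
  next
    case (Cons s w)
    then have "[s] \<otimes>\<^bsub>free_monoid S\<^esub> w \<in> N"
      using N(2) by (intro submonoid.m_closed[OF N(1)]) auto
    then show ?case by (simp add: free_monoid_def)
  qed
  then show "carrier (free_monoid S) \<subseteq> N" by (auto simp: free_monoid_def)
qed (auto simp: free_monoid_def)

text \<open>
  The amalgam is a quotient of a quotient of the free monoid; the following names its relations and
  the resulting map from words.
\<close>

definition amalgam_rels where
  "amalgam_rels M1 M2 h1 h2 =
    {(free_product_inl M1 M2 (h1 [^]\<^bsub>M1\<^esub> k), free_product_inr M1 M2 (h2 [^]\<^bsub>M2\<^esub> k)) | k::nat. True}"

definition word_class where
  "word_class M1 M2 h1 h2 w = cong_class (free_product M1 M2) (amalgam_rels M1 M2 h1 h2)
    (cong_class (free_monoid (carrier M1 <+> carrier M2)) (free_product_rels M1 M2) w)"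

locale cyclic_amalgam_context =
  M1: monoid M1 + M2: monoid M2
  for M1 :: "('a, 'm) monoid_scheme" and M2 :: "('b, 'n) monoid_scheme" +
  fixes h1 h2
  assumes h1_closed: "h1 \<in> carrier M1" and h2_closed: "h2 \<in> carrier M2"
begin

abbreviation words where "words \<equiv> free_monoid (carrier M1 <+> carrier M2)"
abbreviation amalgam where "amalgam \<equiv> cyclic_amalgam M1 M2 h1 h2"
abbreviation wclass where "wclass \<equiv> word_class M1 M2 h1 h2"

sublocale words: monoid words by (rule free_monoid_is_monoid)

sublocale fp: monoid "free_product M1 M2"
  unfolding free_product_def by (rule words.quotient_is_monoid)

lemma amalgam_eq: "amalgam = quotient_monoid (free_product M1 M2) (amalgam_rels M1 M2 h1 h2)"
  by (simp add: cyclic_amalgam_def amalgamated_free_product_def amalgam_rels_def infinite_cyclic_monoid_def)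

sublocale amalgam: monoid amalgam
  unfolding amalgam_eq by (rule fp.quotient_is_monoid)

lemma free_product_carrier:
  "carrier (free_product M1 M2) = cong_class words (free_product_rels M1 M2) ` carrier words"
  unfolding free_product_def by (rule words.quotient_carrier)

lemma free_product_class_hom:
  "cong_class words (free_product_rels M1 M2) \<in> hom words (free_product M1 M2)"
  unfolding free_product_def by (rule words.cong_class_hom)

lemma word_class_hom: "wclass \<in> hom words amalgam"
  using hom_compose[OF free_product_class_hom fp.cong_class_hom[of "amalgam_rels M1 M2 h1 h2"]]
  by (simp add: amalgam_eq word_class_def[abs_def] comp_def)

lemma word_class_one: "wclass \<one>\<^bsub>words\<^esub> = \<one>\<^bsub>amalgam\<^esub>"
  unfolding amalgam_eq fp.quotient_one word_class_def
  by (simp add: free_product_def words.quotient_one)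

lemma word_class_onto: "wclass ` carrier words = carrier amalgam"
  unfolding amalgam_eq fp.quotient_carrier free_product_carrier by (auto simp: word_class_def)

lemma singleton_word: "s \<in> carrier M1 <+> carrier M2 \<Longrightarrow> [s] \<in> carrier words"
  by (simp add: free_monoid_def)

lemma amalgam_generators:
  "(\<lambda>N. submonoid N amalgam) hull
    ((\<lambda>x. wclass [Inl x]) ` carrier M1 \<union> (\<lambda>y. wclass [Inr y]) ` carrier M2) = carrier amalgam"
proof -
  have "wclass ` (\<lambda>s. [s]) ` (carrier M1 <+> carrier M2) =
    (\<lambda>x. wclass [Inl x]) ` carrier M1 \<union> (\<lambda>y. wclass [Inr y]) ` carrier M2"
    by (auto simp: Plus_def image_Un image_image)
  then show ?thesis
    using words.generators_image[OF free_monoid_generators amalgam.monoid_axioms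
        word_class_hom word_class_one word_class_onto] by simp
qed

lemma word_class_relation:
  assumes "(v, w) \<in> free_product_rels M1 M2" "v \<in> carrier words" "w \<in> carrier words"
  shows "wclass v = wclass w"
  unfolding word_class_def using words.cong_class_relation[OF assms] by simp

lemma word_class_append:
  assumes "s \<in> carrier M1 <+> carrier M2" "t \<in> carrier M1 <+> carrier M2"
  shows "wclass [s] \<otimes>\<^bsub>amalgam\<^esub> wclass [t] = wclass [s, t]"
  using hom_mult[OF word_class_hom singleton_word[OF assms(1)] singleton_word[OF assms(2)]]
  by (simp add: free_monoid_def)

lemma inl_hom: "(\<lambda>x. wclass [Inl x]) \<in> hom M1 amalgam"
proof (rule homI)
  fix x y assume xy: "x \<in> carrier M1" "y \<in> carrier M1"
  have "wclass [Inl x, Inl y] = wclass [Inl (x \<otimes>\<^bsub>M1\<^esub> y)]"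
    by (rule word_class_relation) (use xy in \<open>auto simp: free_product_rels_def free_monoid_def\<close>)
  then show "wclass [Inl (x \<otimes>\<^bsub>M1\<^esub> y)] = wclass [Inl x] \<otimes>\<^bsub>amalgam\<^esub> wclass [Inl y]"
    using word_class_append[of "Inl x" "Inl y"] xy by (simp add: InlI InrI)
qed (auto intro: hom_in_carrier[OF word_class_hom singleton_word])

lemma inr_hom: "(\<lambda>y. wclass [Inr y]) \<in> hom M2 amalgam"
proof (rule homI)
  fix x y assume xy: "x \<in> carrier M2" "y \<in> carrier M2"
  have "wclass [Inr x, Inr y] = wclass [Inr (x \<otimes>\<^bsub>M2\<^esub> y)]"
    by (rule word_class_relation) (use xy in \<open>auto simp: free_product_rels_def free_monoid_def\<close>)
  then show "wclass [Inr (x \<otimes>\<^bsub>M2\<^esub> y)] = wclass [Inr x] \<otimes>\<^bsub>amalgam\<^esub> wclass [Inr y]"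
    using word_class_append[of "Inr x" "Inr y"] xy by (simp add: InlI InrI)
qed (auto intro: hom_in_carrier[OF word_class_hom singleton_word])

lemma inl_one: "wclass [Inl \<one>\<^bsub>M1\<^esub>] = \<one>\<^bsub>amalgam\<^esub>"
  unfolding word_class_one[symmetric]
  by (rule word_class_relation) (auto simp: free_product_rels_def free_monoid_def)

lemma inr_one: "wclass [Inr \<one>\<^bsub>M2\<^esub>] = \<one>\<^bsub>amalgam\<^esub>"
  unfolding word_class_one[symmetric]
  by (rule word_class_relation) (auto simp: free_product_rels_def free_monoid_def)

lemma inl_in_free_product: "x \<in> carrier M1 \<Longrightarrow> free_product_inl M1 M2 x \<in> carrier (free_product M1 M2)"
  unfolding free_product_inl_def free_product_carrier by (auto intro: singleton_word)

lemma inr_in_free_product: "y \<in> carrier M2 \<Longrightarrow> free_product_inr M1 M2 y \<in> carrier (free_product M1 M2)"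
  unfolding free_product_inr_def free_product_carrier by (auto intro: singleton_word)

lemma roots_identified: "wclass [Inl h1] = wclass [Inr h2]"
proof -
  have "(free_product_inl M1 M2 (h1 [^]\<^bsub>M1\<^esub> (1::nat)), free_product_inr M1 M2 (h2 [^]\<^bsub>M2\<^esub> (1::nat)))
      \<in> amalgam_rels M1 M2 h1 h2"
    unfolding amalgam_rels_def by blast
  then have "(free_product_inl M1 M2 h1, free_product_inr M1 M2 h2) \<in> amalgam_rels M1 M2 h1 h2"
    using h1_closed h2_closed by simp
  then show ?thesis
    unfolding word_class_def free_product_inl_def[symmetric] free_product_inr_def[symmetric]
    by (intro fp.cong_class_relation inl_in_free_product inr_in_free_product h1_closed h2_closed)
qed

lemma amalgam_universal:
  assumes P: "monoid P"
    and f1: "f1 \<in> hom M1 P" "f1 \<one>\<^bsub>M1\<^esub> = \<one>\<^bsub>P\<^esub>" and f2: "f2 \<in> hom M2 P" "f2 \<one>\<^bsub>M2\<^esub> = \<one>\<^bsub>P\<^esub>"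
    and f_root: "f1 h1 = f2 h2"
  shows "\<exists>F\<in>hom amalgam P. F \<one>\<^bsub>amalgam\<^esub> = \<one>\<^bsub>P\<^esub> \<and>
    (\<forall>x\<in>carrier M1. F (wclass [Inl x]) = f1 x) \<and> (\<forall>y\<in>carrier M2. F (wclass [Inr y]) = f2 y)"
proof -
  interpret P: monoid P by (rule P)
  define letter where "letter = case_sum f1 f2"
  define ev where "ev w = foldr (\<lambda>s p. letter s \<otimes>\<^bsub>P\<^esub> p) w \<one>\<^bsub>P\<^esub>" for w
  have letter: "letter s \<in> carrier P" if "s \<in> carrier M1 <+> carrier M2" for s
    using that f1 f2 by (auto simp: letter_def hom_in_carrier)
  have ev_closed: "ev w \<in> carrier P" if "w \<in> lists (carrier M1 <+> carrier M2)" for w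
    using that letter by (induction w) (auto simp: ev_def)
  have ev_append: "ev (v @ w) = ev v \<otimes>\<^bsub>P\<^esub> ev w"
    if "v \<in> lists (carrier M1 <+> carrier M2)" "w \<in> lists (carrier M1 <+> carrier M2)" for v w
    using that
  proof (induction v)
    case Nil then show ?case using ev_closed by (simp add: ev_def)
  next
    case (Cons s v)
    then have "ev (s # v @ w) = letter s \<otimes>\<^bsub>P\<^esub> (ev v \<otimes>\<^bsub>P\<^esub> ev w)" by (simp add: ev_def)
    also have "\<dots> = ev (s # v) \<otimes>\<^bsub>P\<^esub> ev w"
      using Cons ev_closed[of v] ev_closed[of w] letter[of s] by (simp add: P.m_assoc ev_def)
    finally show ?case by simp
  qed
  have ev_hom: "ev \<in> hom words P"
    by (rule homI) (auto simp: free_monoid_def ev_closed ev_append)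
  have ev_letter: "ev [s] = letter s" if "s \<in> carrier M1 <+> carrier M2" for s
    using letter[OF that] by (simp add: ev_def)
  have ev_rels: "ev v = ev w" if "(v, w) \<in> free_product_rels M1 M2" for v w
    using that hom_in_carrier[OF f1(1)] hom_in_carrier[OF f2(1)] hom_mult[OF f1(1)] hom_mult[OF f2(1)] f1(2) f2(2)
    by (auto simp: free_product_rels_def ev_def letter_def P.m_assoc)
  obtain F1 where F1: "F1 \<in> hom (free_product M1 M2) P"
    "\<And>w. w \<in> carrier words \<Longrightarrow> F1 (cong_class words (free_product_rels M1 M2) w) = ev w"
    using words.quotient_universal[OF ev_hom ev_rels] unfolding free_product_def by blast
  have F1_inl: "F1 (free_product_inl M1 M2 x) = f1 x" if "x \<in> carrier M1" for x
    using that F1(2)[of "[Inl x]"] ev_letter[of "Inl x"] singleton_word[of "Inl x"]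
    by (simp add: free_product_inl_def letter_def InlI)
  have F1_inr: "F1 (free_product_inr M1 M2 y) = f2 y" if "y \<in> carrier M2" for y
    using that F1(2)[of "[Inr y]"] ev_letter[of "Inr y"] singleton_word[of "Inr y"]
    by (simp add: free_product_inr_def letter_def InrI)
  have "f1 (h1 [^]\<^bsub>M1\<^esub> k) = f2 (h2 [^]\<^bsub>M2\<^esub> k)" for k :: nat
    using M1.hom_pow[OF P f1 h1_closed] M2.hom_pow[OF P f2 h2_closed] f_root by simp
  then have F1_rels: "F1 x = F1 y" if "(x, y) \<in> amalgam_rels M1 M2 h1 h2" for x y
    using that h1_closed h2_closed by (auto simp: amalgam_rels_def F1_inl F1_inr)
  obtain F where F: "F \<in> hom amalgam P"
    "\<And>x. x \<in> carrier (free_product M1 M2) \<Longrightarrow> F (cong_class (free_product M1 M2) (amalgam_rels M1 M2 h1 h2) x) = F1 x"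
    using fp.quotient_universal[OF F1(1) F1_rels] unfolding amalgam_eq by blast
  have F_word: "F (wclass w) = ev w" if "w \<in> carrier words" for w
    using that F(2) F1(2) free_product_carrier by (simp add: word_class_def)
  have "F \<one>\<^bsub>amalgam\<^esub> = \<one>\<^bsub>P\<^esub>"
    unfolding word_class_one[symmetric] using F_word[OF words.one_closed]
    by (simp add: ev_def free_monoid_def)
  moreover have "F (wclass [s]) = letter s" if "s \<in> carrier M1 <+> carrier M2" for s
    using F_word[OF singleton_word[OF that]] ev_letter[OF that] by simp
  then have "\<forall>x\<in>carrier M1. F (wclass [Inl x]) = f1 x" "\<forall>y\<in>carrier M2. F (wclass [Inr y]) = f2 y"
    by (simp_all add: letter_def InlI InrI)
  ultimately show ?thesis using F(1) by blast
qed

end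

section \<open>Normal forms\<close>

lemma rooted_monoid_transfer:
  assumes "rooted_monoid G h" and K: "monoid K"
    and f: "f \<in> hom G K" "f \<one>\<^bsub>G\<^esub> = \<one>\<^bsub>K\<^esub>" "inj_on f (carrier G)" "f ` carrier G = carrier K"
  shows "rooted_monoid K (f h)"
proof -
  interpret G: rooted_monoid G h by (rule assms)
  interpret K: monoid K by (rule K)
  have mult: "f (x \<otimes>\<^bsub>G\<^esub> y) = f x \<otimes>\<^bsub>K\<^esub> f y" if "x \<in> carrier G" "y \<in> carrier G" for x y
    using hom_mult[OF f(1) that] .
  have eq: "f x = f y \<longleftrightarrow> x = y" if "x \<in> carrier G" "y \<in> carrier G" for x y
    using f(3) that by (auto dest: inj_onD)
  have pow: "f x [^]\<^bsub>K\<^esub> k = f (x [^]\<^bsub>G\<^esub> k)" if "x \<in> carrier G" for x and k :: nat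
    using G.hom_pow[OF K f(1,2) that] by simp
  have dvd: "f x divides\<^bsub>K\<^esub> f y \<longleftrightarrow> x divides\<^bsub>G\<^esub> y" if "x \<in> carrier G" "y \<in> carrier G" for x y
    unfolding factor_def f(4)[symmetric] using that by (auto simp: eq simp flip: mult)
  show ?thesis
  proof unfold_locales
    fix a b assume "a \<in> carrier K" "b \<in> carrier K"
    then obtain x y where xy: "x \<in> carrier G" "a = f x" "y \<in> carrier G" "b = f y"
      unfolding f(4)[symmetric] by blast
    obtain l where l: "l \<in> carrier G" "l lcmof\<^bsub>G\<^esub> x y" using G.right_lcm xy by blast
    then have "f l lcmof\<^bsub>K\<^esub> a b"
      unfolding islcm_def f(4)[symmetric] using xy by (auto simp: dvd)
    then show "\<exists>c\<in>carrier K. c lcmof\<^bsub>K\<^esub> a b" using l f(4) by blast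
    show "a = \<one>\<^bsub>K\<^esub> \<and> b = \<one>\<^bsub>K\<^esub>" if "a \<otimes>\<^bsub>K\<^esub> b = \<one>\<^bsub>K\<^esub>"
      using that xy G.conical[of x y] eq[of "x \<otimes>\<^bsub>G\<^esub> y" "\<one>\<^bsub>G\<^esub>"] f(2) by (simp add: mult)
    fix c assume "c \<in> carrier K"
    then obtain z where z: "z \<in> carrier G" "c = f z" unfolding f(4)[symmetric] by blast
    show "a = b" if "c \<otimes>\<^bsub>K\<^esub> a = c \<otimes>\<^bsub>K\<^esub> b"
      using that xy z G.l_cancel[of z x y] eq[of "z \<otimes>\<^bsub>G\<^esub> x" "z \<otimes>\<^bsub>G\<^esub> y"] by (simp add: mult)
    show "a = b" if "a \<otimes>\<^bsub>K\<^esub> c = b \<otimes>\<^bsub>K\<^esub> c"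
      using that xy z G.r_cancel[of x z y] eq[of "x \<otimes>\<^bsub>G\<^esub> z" "y \<otimes>\<^bsub>G\<^esub> z"] by (simp add: mult)
  next
    fix a assume "a \<in> carrier K"
    then obtain x where x: "x \<in> carrier G" "a = f x" unfolding f(4)[symmetric] by blast
    show "\<exists>k::nat. a divides\<^bsub>K\<^esub> f h [^]\<^bsub>K\<^esub> k"
      using G.root_bounds[OF x(1)] x by (simp add: pow dvd)
    have "K.factorizations a \<subseteq> map_prod f f ` G.factorizations x"
    proof clarify
      fix b c assume "(b, c) \<in> K.factorizations a"
      then have "b \<in> carrier K" "c \<in> carrier K" "a = b \<otimes>\<^bsub>K\<^esub> c"
        by (simp_all add: K.factorizations_def)
      then obtain u v where "u \<in> carrier G" "b = f u" "v \<in> carrier G" "c = f v" "f (u \<otimes>\<^bsub>G\<^esub> v) = f x"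
        unfolding f(4)[symmetric] x(2) by (auto simp: mult)
      then show "(b, c) \<in> map_prod f f ` G.factorizations x"
        using x by (auto simp: eq G.factorizations_def intro!: image_eqI[of _ _ "(u, v)"])
    qed
    then show "finite (K.factorizations a)"
      using G.finite_factorizations[OF x(1)] by (meson finite_imageI finite_subset)
  next
    obtain N :: nat where N: "1 \<le> N" "\<forall>x\<in>carrier G. x \<otimes>\<^bsub>G\<^esub> h [^]\<^bsub>G\<^esub> N = h [^]\<^bsub>G\<^esub> N \<otimes>\<^bsub>G\<^esub> x"
      using G.root_central by blast
    then have "\<forall>a\<in>carrier K. a \<otimes>\<^bsub>K\<^esub> f h [^]\<^bsub>K\<^esub> N = f h [^]\<^bsub>K\<^esub> N \<otimes>\<^bsub>K\<^esub> a"
      unfolding f(4)[symmetric] by (simp add: pow flip: mult)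
    with N(1) show "\<exists>N::nat. 1 \<le> N \<and> (\<forall>a\<in>carrier K. a \<otimes>\<^bsub>K\<^esub> f h [^]\<^bsub>K\<^esub> N = f h [^]\<^bsub>K\<^esub> N \<otimes>\<^bsub>K\<^esub> a)"
      by blast
    show "f h \<in> carrier K" using f(4) by auto
    show "f h \<noteq> \<one>\<^bsub>K\<^esub>" using eq[of h "\<one>\<^bsub>G\<^esub>"] f(2) G.root_neq_one by simp
  qed
qed

text \<open>
  The pair \<open>(k, [(i\<^sub>1, t\<^sub>1), \<dots>, (i\<^sub>n, t\<^sub>n)])\<close> stands for \<open>h ^ k t\<^sub>1 \<dots> t\<^sub>n\<close>, where \<open>t\<^sub>j\<close> comes from
  the factor \<open>i\<^sub>j\<close>.
\<close>

type_synonym 'c normal_form = "nat \<times> (bool \<times> 'c) list"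

locale amalgam_normal_forms =
  fixes G :: "bool \<Rightarrow> 'c monoid" and r :: "bool \<Rightarrow> 'c"
  assumes rooted: "rooted_monoid (G i) (r i)"
begin

sublocale G: rooted_monoid "G i" "r i" for i by (rule rooted)

abbreviation rpow where "rpow i k \<equiv> r i [^]\<^bsub>G i\<^esub> (k::nat)"

definition root_split :: "bool \<Rightarrow> 'c \<Rightarrow> nat \<times> 'c"
  where "root_split i y = (SOME (k, t). t \<in> carrier (G i) \<and> \<not> r i divides\<^bsub>G i\<^esub> t \<and> y = rpow i k \<otimes>\<^bsub>G i\<^esub> t)"

lemma root_split_eqI:
  assumes "t \<in> carrier (G i)" "\<not> r i divides\<^bsub>G i\<^esub> t" "y = rpow i k \<otimes>\<^bsub>G i\<^esub> t"
  shows "root_split i y = (k, t)"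
  unfolding root_split_def
proof (rule some_equality)
  fix p assume p: "case p of (k, t) \<Rightarrow> t \<in> carrier (G i) \<and> \<not> r i divides\<^bsub>G i\<^esub> t \<and> y = rpow i k \<otimes>\<^bsub>G i\<^esub> t"
  obtain k' t' where p_eq: "p = (k', t')" by (cases p)
  then show "p = (k, t)"
    using G.root_decomposition_unique[of t' i t k' k] p assms by simp
qed (use assms in simp)

lemma root_splitE:
  assumes "y \<in> carrier (G i)"
  obtains k t where "root_split i y = (k, t)" "t \<in> carrier (G i)" "\<not> r i divides\<^bsub>G i\<^esub> t"
    "y = rpow i k \<otimes>\<^bsub>G i\<^esub> t"
  using G.root_decomposition[OF assms] root_split_eqI by metis

lemma root_split_power: "root_split i (rpow i k) = (k, \<one>\<^bsub>G i\<^esub>)"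
  by (rule root_split_eqI) (simp_all add: G.root_not_divides_one)

text \<open>
  The index is the side on which a tail must not start, so that the tails for \<open>i\<close> form a basis over
  the factor \<open>i\<close>.
\<close>

fun tail :: "bool \<Rightarrow> (bool \<times> 'c) list \<Rightarrow> bool" where
  "tail i [] \<longleftrightarrow> True"
| "tail i ((j, t) # ts) \<longleftrightarrow> j \<noteq> i \<and> t \<in> carrier (G j) \<and> t \<noteq> \<one>\<^bsub>G j\<^esub> \<and> \<not> r j divides\<^bsub>G j\<^esub> t \<and> tail j ts"

definition normal_forms :: "'c normal_form set"
  where "normal_forms = {(k, ts). \<exists>i. tail i ts}"

text \<open>
  The maps \<open>combine i\<close> and \<open>separate i\<close> are mutually inverse bijections between pairs of a
  factor element and a tail, and normal forms; through them the normal forms become a free left set.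
\<close>

definition combine :: "bool \<Rightarrow> 'c \<times> (bool \<times> 'c) list \<Rightarrow> 'c normal_form"
  where "combine i = (\<lambda>(y, ts). case root_split i y of (k, t) \<Rightarrow>
    if t = \<one>\<^bsub>G i\<^esub> then (k, ts) else (k, (i, t) # ts))"

fun separate :: "bool \<Rightarrow> 'c normal_form \<Rightarrow> 'c \<times> (bool \<times> 'c) list" where
  "separate i (k, []) = (rpow i k, [])"
| "separate i (k, (j, t) # ts) = (if j = i then (rpow i k \<otimes>\<^bsub>G i\<^esub> t, ts) else (rpow i k, (j, t) # ts))"

lemma separate_tail: "tail i ts \<Longrightarrow> separate i (k, ts) = (rpow i k, ts)"
  by (cases ts) auto

lemma separate_closed:
  assumes "x \<in> normal_forms" "separate i x = (y, ts)"
  shows "y \<in> carrier (G i)" "tail i ts"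
  using assms by (induction i x rule: separate.induct) (auto simp: normal_forms_def split: if_splits)

lemma combine_closed:
  assumes "y \<in> carrier (G i)" "tail i ts"
  shows "combine i (y, ts) \<in> normal_forms"
proof -
  obtain k t where "root_split i y = (k, t)" "t \<in> carrier (G i)" "\<not> r i divides\<^bsub>G i\<^esub> t"
    using root_splitE[OF assms(1)] by metis
  then show ?thesis using assms(2) by (auto simp: combine_def normal_forms_def intro: exI[of _ "\<not> i"])
qed

lemma combine_separate: "x \<in> normal_forms \<Longrightarrow> combine i (separate i x) = x"
  by (induction i x rule: separate.induct)
    (auto simp: combine_def normal_forms_def root_split_power root_split_eqI)

lemma separate_combine:
  assumes "y \<in> carrier (G i)" "tail i ts"
  shows "separate i (combine i (y, ts)) = (y, ts)"
proof -
  obtain k t where "root_split i y = (k, t)" "y = rpow i k \<otimes>\<^bsub>G i\<^esub> t"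
    using root_splitE[OF assms(1)] by metis
  then show ?thesis using assms by (auto simp: combine_def separate_tail)
qed

text \<open>
  The identity outside the normal forms makes the laws of an action hold on the whole type, so that
  the action is a homomorphism into the monoid of all its self-maps.
\<close>

definition act :: "bool \<Rightarrow> 'c \<Rightarrow> 'c normal_form \<Rightarrow> 'c normal_form"
  where "act i a x = (if x \<in> normal_forms then case separate i x of (y, ts) \<Rightarrow> combine i (a \<otimes>\<^bsub>G i\<^esub> y, ts) else x)"

lemma act_combine:
  assumes "a \<in> carrier (G i)" "y \<in> carrier (G i)" "tail i ts"
  shows "act i a (combine i (y, ts)) = combine i (a \<otimes>\<^bsub>G i\<^esub> y, ts)"
  using assms by (simp add: act_def combine_closed separate_combine)

lemma normal_form_cases:
  assumes "x \<in> normal_forms"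
  obtains y ts where "y \<in> carrier (G i)" "tail i ts" "x = combine i (y, ts)"
  using separate_closed[OF assms] combine_separate[OF assms] by (metis surj_pair)

lemma act_one: "act i \<one>\<^bsub>G i\<^esub> = id"
proof
  fix x show "act i \<one>\<^bsub>G i\<^esub> x = id x"
  proof (cases "x \<in> normal_forms")
    case True
    then show ?thesis by (rule normal_form_cases[of x i]) (simp add: act_combine)
  qed (simp add: act_def)
qed

lemma act_mult:
  assumes "a \<in> carrier (G i)" "b \<in> carrier (G i)"
  shows "act i (a \<otimes>\<^bsub>G i\<^esub> b) = act i a \<circ> act i b"
proof
  fix x show "act i (a \<otimes>\<^bsub>G i\<^esub> b) x = (act i a \<circ> act i b) x"
  proof (cases "x \<in> normal_forms")
    case True
    then show ?thesis
      by (rule normal_form_cases[of x i]) (use assms in \<open>simp add: act_combine G.m_assoc\<close>)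
  qed (simp add: act_def)
qed

lemma combine_root_power: "combine i (rpow i k, ts) = (k, ts)"
  by (simp add: combine_def root_split_power)

text \<open>
  The two actions agree on the roots: on either side the root raises the exponent by one, whether
  or not the first letter of the tail belongs to that side.
\<close>

lemma act_root:
  assumes "(k, ts) \<in> normal_forms"
  shows "act i (r i) (k, ts) = (Suc k, ts)"
proof (cases "\<exists>t ts'. ts = (i, t) # ts'")
  case True
  then obtain t ts' where ts: "ts = (i, t) # ts'" by blast
  then have t: "t \<in> carrier (G i)" "t \<noteq> \<one>\<^bsub>G i\<^esub>" "\<not> r i divides\<^bsub>G i\<^esub> t"
    using assms by (auto simp: normal_forms_def)
  have "r i \<otimes>\<^bsub>G i\<^esub> (rpow i k \<otimes>\<^bsub>G i\<^esub> t) = rpow i (Suc k) \<otimes>\<^bsub>G i\<^esub> t"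
    unfolding G.nat_pow_Suc2[OF G.root_closed] using t by (simp add: G.m_assoc)
  then have "root_split i (r i \<otimes>\<^bsub>G i\<^esub> (rpow i k \<otimes>\<^bsub>G i\<^esub> t)) = (Suc k, t)"
    using t by (intro root_split_eqI)
  then show ?thesis using assms t by (simp add: act_def ts combine_def)
next
  case False
  then have "separate i (k, ts) = (rpow i k, ts)" by (cases ts) auto
  moreover have "r i \<otimes>\<^bsub>G i\<^esub> rpow i k = rpow i (Suc k)"
    by (rule G.nat_pow_Suc2[OF G.root_closed, symmetric])
  ultimately show ?thesis using assms by (simp add: act_def combine_root_power del: nat_pow_Suc G.nat_pow_Suc)
qed

lemma act_closed: "x \<in> normal_forms \<Longrightarrow> a \<in> carrier (G i) \<Longrightarrow> act i a x \<in> normal_forms"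
  by (rule normal_form_cases[of x i]) (simp_all add: act_combine combine_closed)

end

text \<open>
  A monoid generated by images of the two factors that identify the roots, on which the actions on
  normal forms extend to one action \<open>\<Phi>\<close>. Generation makes every element the value of a normal form,
  and the action makes that normal form unique.
\<close>

locale amalgam_presentation = amalgam_normal_forms G r + M: monoid M
  for G :: "bool \<Rightarrow> 'c monoid" and r and M :: "('d, 'k) monoid_scheme" +
  fixes e :: "bool \<Rightarrow> 'c \<Rightarrow> 'd" and \<Phi> :: "'d \<Rightarrow> 'c normal_form \<Rightarrow> 'c normal_form"
  assumes e_hom: "e i \<in> hom (G i) M"
    and e_one: "e i \<one>\<^bsub>G i\<^esub> = \<one>\<^bsub>M\<^esub>"
    and e_root: "e i (r i) = e j (r j)"
    and e_generate: "(\<lambda>N. submonoid N M) hull (e True ` carrier (G True) \<union> e False ` carrier (G False)) = carrier M"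
    and \<Phi>_one: "\<Phi> \<one>\<^bsub>M\<^esub> = id"
    and \<Phi>_mult: "\<lbrakk>x \<in> carrier M; y \<in> carrier M\<rbrakk> \<Longrightarrow> \<Phi> (x \<otimes>\<^bsub>M\<^esub> y) = \<Phi> x \<circ> \<Phi> y"
    and \<Phi>_factor: "a \<in> carrier (G i) \<Longrightarrow> \<Phi> (e i a) = act i a"
begin

definition root where "root = e True (r True)"

lemma e_closed: "a \<in> carrier (G i) \<Longrightarrow> e i a \<in> carrier M"
  using e_hom by (rule hom_in_carrier)

lemma e_mult: "\<lbrakk>a \<in> carrier (G i); b \<in> carrier (G i)\<rbrakk> \<Longrightarrow> e i (a \<otimes>\<^bsub>G i\<^esub> b) = e i a \<otimes>\<^bsub>M\<^esub> e i b"
  using e_hom by (rule hom_mult)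

lemma root_closed: "root \<in> carrier M"
  by (simp add: root_def e_closed)

lemma e_root_power: "e i (rpow i k) = root [^]\<^bsub>M\<^esub> k"
  using G.hom_pow[OF M.monoid_axioms e_hom e_one G.root_closed] e_root[of i True] by (simp add: root_def)

definition tail_value :: "(bool \<times> 'c) list \<Rightarrow> 'd"
  where "tail_value ts = foldr (\<lambda>(j, t) m. e j t \<otimes>\<^bsub>M\<^esub> m) ts \<one>\<^bsub>M\<^esub>"

definition nf_value :: "'c normal_form \<Rightarrow> 'd"
  where "nf_value = (\<lambda>(k, ts). root [^]\<^bsub>M\<^esub> k \<otimes>\<^bsub>M\<^esub> tail_value ts)"

lemma tail_value_simps [simp]:
  "tail_value [] = \<one>\<^bsub>M\<^esub>" "tail_value ((j, t) # ts) = e j t \<otimes>\<^bsub>M\<^esub> tail_value ts"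
  by (simp_all add: tail_value_def)

lemma tail_value_closed: "tail i ts \<Longrightarrow> tail_value ts \<in> carrier M"
  by (induction i ts rule: tail.induct) (auto simp: e_closed)

lemma nf_value_combine:
  assumes "y \<in> carrier (G i)" "tail i ts"
  shows "nf_value (combine i (y, ts)) = e i y \<otimes>\<^bsub>M\<^esub> tail_value ts"
proof -
  obtain k t where t: "root_split i y = (k, t)" "t \<in> carrier (G i)" "y = rpow i k \<otimes>\<^bsub>G i\<^esub> t"
    using root_splitE[OF assms(1)] by metis
  have "e i y = root [^]\<^bsub>M\<^esub> k \<otimes>\<^bsub>M\<^esub> e i t"
    unfolding t(3) by (subst e_mult) (simp_all add: t(2) e_root_power)
  then show ?thesis
    using t tail_value_closed[OF assms(2)] root_closed e_closed[OF t(2)]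
    by (simp add: combine_def nf_value_def M.m_assoc e_one)
qed

lemma nf_value_act:
  assumes "a \<in> carrier (G i)" "x \<in> normal_forms"
  shows "e i a \<otimes>\<^bsub>M\<^esub> nf_value x = nf_value (act i a x)"
  using assms(2)
proof (rule normal_form_cases[of x i])
  fix y ts assume y: "y \<in> carrier (G i)" "tail i ts" "x = combine i (y, ts)"
  then show ?thesis
    using assms(1) tail_value_closed[OF y(2)]
    by (simp add: act_combine nf_value_combine e_mult e_closed M.m_assoc)
qed

lemma nf_value_closed: "x \<in> normal_forms \<Longrightarrow> nf_value x \<in> carrier M"
  by (auto simp: normal_forms_def nf_value_def tail_value_closed root_closed)

lemma nf_value_onto:
  assumes "m \<in> carrier M"
  shows "\<exists>x\<in>normal_forms. m = nf_value x"
proof -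
  have "\<forall>x\<in>normal_forms. \<exists>x'\<in>normal_forms. m \<otimes>\<^bsub>M\<^esub> nf_value x = nf_value x'"
    using e_generate assms
  proof (induction rule: M.hull_submonoid_induct)
    case (gen s)
    then obtain i a where "a \<in> carrier (G i)" "s = e i a" by blast
    then show ?case using nf_value_act act_closed by blast
  next
    case one
    then show ?case using nf_value_closed by auto
  next
    case (mult x y)
    show ?case
    proof
      fix z assume z: "z \<in> normal_forms"
      then obtain z' where z': "z' \<in> normal_forms" "y \<otimes>\<^bsub>M\<^esub> nf_value z = nf_value z'"
        using mult(4) by blast
      obtain z'' where "z'' \<in> normal_forms" "x \<otimes>\<^bsub>M\<^esub> nf_value z' = nf_value z''"
        using mult(3) z'(1) by blast
      moreover have "x \<otimes>\<^bsub>M\<^esub> y \<otimes>\<^bsub>M\<^esub> nf_value z = x \<otimes>\<^bsub>M\<^esub> nf_value z'"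
        using mult(1,2) nf_value_closed[OF z] z'(2) by (simp add: M.m_assoc)
      ultimately show "\<exists>x'\<in>normal_forms. x \<otimes>\<^bsub>M\<^esub> y \<otimes>\<^bsub>M\<^esub> nf_value z = nf_value x'" by auto
    qed
  qed
  moreover have "(0, []) \<in> normal_forms" by (simp add: normal_forms_def)
  moreover have "m \<otimes>\<^bsub>M\<^esub> nf_value (0, []) = m" using assms by (simp add: nf_value_def)
  ultimately show ?thesis by metis
qed

lemma \<Phi>_tail_value: "tail i ts \<Longrightarrow> \<Phi> (tail_value ts) (0, []) = (0, ts)"
proof (induction i ts rule: tail.induct)
  case (1 i)
  then show ?case by (simp add: \<Phi>_one)
next
  case (2 i j t ts)
  then have t: "t \<in> carrier (G j)" "t \<noteq> \<one>\<^bsub>G j\<^esub>" "\<not> r j divides\<^bsub>G j\<^esub> t" "tail j ts" by auto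
  have nf: "(0, ts) = combine j (\<one>\<^bsub>G j\<^esub>, ts)"
    using combine_root_power[of j 0 ts] by simp
  have "root_split j t = (0, t)" using t by (intro root_split_eqI) auto
  then have "act j t (0, ts) = (0, (j, t) # ts)"
    unfolding nf using t by (simp add: act_combine) (simp add: combine_def)
  then show ?case
    using 2 t by (simp add: \<Phi>_mult \<Phi>_factor e_closed tail_value_closed)
qed

lemma \<Phi>_nf_value:
  assumes "x \<in> normal_forms"
  shows "\<Phi> (nf_value x) (0, []) = x"
proof -
  obtain k ts i where x: "x = (k, ts)" "tail i ts" using assms by (auto simp: normal_forms_def)
  have root: "\<Phi> (root [^]\<^bsub>M\<^esub> k) = act i (rpow i k)"
    unfolding e_root_power[of i, symmetric] by (rule \<Phi>_factor) simp
  have nf: "(0, ts) = combine i (\<one>\<^bsub>G i\<^esub>, ts)"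
    using combine_root_power[of i 0 ts] by simp
  have "act i (rpow i k) (0, ts) = (k, ts)"
    unfolding nf using x(2) by (simp add: act_combine combine_root_power)
  then show ?thesis
    using x by (simp add: nf_value_def \<Phi>_mult root_closed tail_value_closed root \<Phi>_tail_value)
qed

text \<open>The normal form is recovered from its value by acting on the empty one.\<close>

lemma nf_value_inj: "\<lbrakk>x \<in> normal_forms; y \<in> normal_forms; nf_value x = nf_value y\<rbrakk> \<Longrightarrow> x = y"
  using \<Phi>_nf_value by metis

lemma e_tail_unique:
  assumes "y \<in> carrier (G i)" "tail i ts" "y' \<in> carrier (G i)" "tail i ts'"
    and "e i y \<otimes>\<^bsub>M\<^esub> tail_value ts = e i y' \<otimes>\<^bsub>M\<^esub> tail_value ts'"
  shows "y = y' \<and> ts = ts'"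
proof -
  have "combine i (y, ts) = combine i (y', ts')"
    using assms by (intro nf_value_inj combine_closed) (simp_all add: nf_value_combine)
  then have "separate i (combine i (y, ts)) = separate i (combine i (y', ts'))" by simp
  then show ?thesis using assms by (simp add: separate_combine)
qed

lemma e_inj: "inj_on (e i) (carrier (G i))"
proof (rule inj_onI)
  fix y y' assume "y \<in> carrier (G i)" "y' \<in> carrier (G i)" "e i y = e i y'"
  then show "y = y'" using e_tail_unique[of y i "[]" y' "[]"] by simp
qed

definition factor_set where "factor_set i = e i ` carrier (G i)"
definition tail_set where "tail_set i = tail_value ` {ts. tail i ts}"

lemma factor_submonoid: "submonoid (factor_set i) M"
proof
  show "\<one>\<^bsub>M\<^esub> \<in> factor_set i" unfolding factor_set_def e_one[of i, symmetric] by blast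
  fix x y assume "x \<in> factor_set i" "y \<in> factor_set i"
  then show "x \<otimes>\<^bsub>M\<^esub> y \<in> factor_set i" by (auto simp: factor_set_def simp flip: e_mult)
qed (auto simp: factor_set_def e_closed)

lemma e_hom_factor: "e i \<in> hom (G i) (M\<lparr>carrier := factor_set i\<rparr>)"
  by (rule homI) (auto simp: factor_set_def e_mult)

lemma free_amalgam: "free_amalgam M factor_set tail_set root"
proof (intro free_amalgam.intro free_amalgam_axioms.intro)
  show "monoid M" by (rule M.monoid_axioms)
  fix i
  show "submonoid (factor_set i) M" by (rule factor_submonoid)
  have root: "root = e i (r i)" unfolding root_def by (rule e_root)
  have factor_monoid: "monoid (M\<lparr>carrier := factor_set i\<rparr>)"
    using factor_submonoid M.monoid_axioms by (rule submonoid.submonoid_is_monoid)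
  show "rooted_monoid (M\<lparr>carrier := factor_set i\<rparr>) root"
    unfolding root
    by (rule rooted_monoid_transfer[OF rooted factor_monoid e_hom_factor _ e_inj])
      (simp_all add: e_one factor_set_def)
  show "(\<lambda>N. submonoid N M) hull (factor_set True \<union> factor_set False) = carrier M"
    using e_generate by (simp add: factor_set_def)
  show "\<tau> \<in> carrier M" if "\<tau> \<in> tail_set i" for \<tau>
    using that by (auto simp: tail_set_def tail_value_closed)
  show "\<one>\<^bsub>M\<^esub> \<in> tail_set i" unfolding tail_set_def by (rule image_eqI[of _ _ "[]"]) auto
  show "\<exists>y\<in>factor_set i. \<exists>\<tau>\<in>tail_set i. m = y \<otimes>\<^bsub>M\<^esub> \<tau>" if m: "m \<in> carrier M" for m
  proof -
    obtain x where x: "x \<in> normal_forms" "m = nf_value x" using nf_value_onto[OF m] by blast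
    obtain y ts where "y \<in> carrier (G i)" "tail i ts" "x = combine i (y, ts)"
      using normal_form_cases[OF x(1)] by blast
    then show ?thesis unfolding x(2) by (auto simp: factor_set_def tail_set_def nf_value_combine)
  qed
  show "y = y' \<and> \<tau> = \<tau>'"
    if "y \<in> factor_set i" "\<tau> \<in> tail_set i" "y' \<in> factor_set i" "\<tau>' \<in> tail_set i" "y \<otimes>\<^bsub>M\<^esub> \<tau> = y' \<otimes>\<^bsub>M\<^esub> \<tau>'"
    for y \<tau> y' \<tau>'
    using that e_tail_unique by (auto simp: factor_set_def tail_set_def) blast+
  show "t \<otimes>\<^bsub>M\<^esub> \<tau> \<in> tail_set (\<not> i)"
    if t: "t \<in> factor_set i" "t \<noteq> \<one>\<^bsub>M\<^esub>" "\<not> root divides\<^bsub>M\<lparr>carrier := factor_set i\<rparr>\<^esub> t" "\<tau> \<in> tail_set i"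
    for t \<tau>
  proof -
    obtain s where s: "s \<in> carrier (G i)" "t = e i s" using t(1) by (auto simp: factor_set_def)
    obtain ts where ts: "tail i ts" "\<tau> = tail_value ts" using t(4) by (auto simp: tail_set_def)
    have "s \<noteq> \<one>\<^bsub>G i\<^esub>" using t(2) s(2) e_one by auto
    moreover have "\<not> r i divides\<^bsub>G i\<^esub> s"
    proof
      assume "r i divides\<^bsub>G i\<^esub> s"
      then obtain u where "u \<in> carrier (G i)" "s = r i \<otimes>\<^bsub>G i\<^esub> u" by (elim dividesE)
      then have "t = root \<otimes>\<^bsub>M\<^esub> e i u" "e i u \<in> factor_set i"
        using s(2) root by (auto simp: e_mult factor_set_def)
      then show False using t(3) by (auto simp: factor_set_def Divisibility.factor_def)
    qed
    ultimately have "tail (\<not> i) ((i, s) # ts)" using s ts by simp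
    moreover have "t \<otimes>\<^bsub>M\<^esub> \<tau> = tail_value ((i, s) # ts)" using s ts by simp
    ultimately show ?thesis unfolding tail_set_def by blast
  qed
qed

end

section \<open>The cyclic amalgam is Garside\<close>

text \<open>
  Copies of the two monoids inside the sum type give them a common element type, as a family
  indexed by a truth value requires.
\<close>

definition copy_monoid :: "('a \<Rightarrow> 'c) \<Rightarrow> ('c \<Rightarrow> 'a) \<Rightarrow> ('a, 'm) monoid_scheme \<Rightarrow> 'c monoid"
  where "copy_monoid f g M =
    \<lparr>carrier = f ` carrier M, mult = (\<lambda>x y. f (g x \<otimes>\<^bsub>M\<^esub> g y)), one = f \<one>\<^bsub>M\<^esub>\<rparr>"

lemma rooted_copy_monoid:
  assumes "rooted_monoid M h" and gf: "\<And>x. g (f x) = x"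
  shows "rooted_monoid (copy_monoid f g M) (f h)"
proof -
  interpret M: rooted_monoid M h by (rule assms)
  show ?thesis
  proof (rule rooted_monoid_transfer[OF assms(1)])
    show "monoid (copy_monoid f g M)"
      by (rule monoidI) (auto simp: copy_monoid_def gf M.m_assoc)
    show "f \<in> hom M (copy_monoid f g M)"
      by (rule homI) (auto simp: copy_monoid_def gf)
    show "inj_on f (carrier M)" using gf by (metis inj_onI)
  qed (simp_all add: copy_monoid_def)
qed

lemma cyclic_amalgam_free:
  fixes M1 :: "('a, 'm) monoid_scheme" and M2 :: "('b, 'n) monoid_scheme"
  assumes R1: "rooted_monoid M1 h1" and R2: "rooted_monoid M2 h2"
  shows "\<exists>A T h. free_amalgam (cyclic_amalgam M1 M2 h1 h2) A T h"
proof -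
  interpret M1: rooted_monoid M1 h1 by (rule R1)
  interpret M2: rooted_monoid M2 h2 by (rule R2)
  interpret cyclic_amalgam_context M1 M2 h1 h2 by unfold_locales auto
  define G where "G i = (if i then copy_monoid Inl projl M1 else copy_monoid Inr projr M2)" for i
  define r where "r i = (if i then Inl h1 else Inr h2)" for i
  define e where "e i s = wclass [s]" for i :: bool and s
  interpret nf: amalgam_normal_forms G r
    by (rule amalgam_normal_forms.intro) (simp add: G_def r_def rooted_copy_monoid R1 R2)
  define P :: "(('a + 'b) normal_form \<Rightarrow> ('a + 'b) normal_form) monoid"
    where "P = \<lparr>carrier = UNIV, mult = (\<circ>), one = id\<rparr>"
  have P: "monoid P" by (rule monoidI) (auto simp: P_def)
  have "(\<lambda>x. nf.act True (Inl x)) \<in> hom M1 P"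
  proof (rule homI)
    fix x y assume "x \<in> carrier M1" "y \<in> carrier M1"
    then show "nf.act True (Inl (x \<otimes>\<^bsub>M1\<^esub> y)) = nf.act True (Inl x) \<otimes>\<^bsub>P\<^esub> nf.act True (Inl y)"
      using nf.act_mult[of "Inl x" True "Inl y"] by (simp add: P_def G_def copy_monoid_def)
  qed (simp add: P_def)
  moreover have "nf.act True (Inl \<one>\<^bsub>M1\<^esub>) = \<one>\<^bsub>P\<^esub>"
    using nf.act_one[of True] by (simp add: P_def G_def copy_monoid_def)
  moreover have "(\<lambda>y. nf.act False (Inr y)) \<in> hom M2 P"
  proof (rule homI)
    fix x y assume "x \<in> carrier M2" "y \<in> carrier M2"
    then show "nf.act False (Inr (x \<otimes>\<^bsub>M2\<^esub> y)) = nf.act False (Inr x) \<otimes>\<^bsub>P\<^esub> nf.act False (Inr y)"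
      using nf.act_mult[of "Inr x" False "Inr y"] by (simp add: P_def G_def copy_monoid_def)
  qed (simp add: P_def)
  moreover have "nf.act False (Inr \<one>\<^bsub>M2\<^esub>) = \<one>\<^bsub>P\<^esub>"
    using nf.act_one[of False] by (simp add: P_def G_def copy_monoid_def)
  moreover have "nf.act True (Inl h1) = nf.act False (Inr h2)"
  proof
    fix x show "nf.act True (Inl h1) x = nf.act False (Inr h2) x"
    proof (cases "x \<in> nf.normal_forms")
      case True
      obtain k ts where x: "x = (k, ts)" by (cases x)
      show ?thesis
        using nf.act_root[of k ts True] nf.act_root[of k ts False] True by (simp add: x r_def)
    qed (simp add: nf.act_def)
  qed
  ultimately obtain \<Phi> where \<Phi>: "\<Phi> \<in> hom amalgam P" "\<Phi> \<one>\<^bsub>amalgam\<^esub> = \<one>\<^bsub>P\<^esub>"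
    "\<And>x. x \<in> carrier M1 \<Longrightarrow> \<Phi> (wclass [Inl x]) = nf.act True (Inl x)"
    "\<And>y. y \<in> carrier M2 \<Longrightarrow> \<Phi> (wclass [Inr y]) = nf.act False (Inr y)"
    using amalgam_universal[OF P, of "\<lambda>x. nf.act True (Inl x)" "\<lambda>y. nf.act False (Inr y)"] by blast
  have "amalgam_presentation G r amalgam e \<Phi>"
  proof (intro amalgam_presentation.intro amalgam_presentation_axioms.intro)
    show "amalgam_normal_forms G r" by (rule nf.amalgam_normal_forms_axioms)
    show "monoid amalgam" by (rule amalgam.monoid_axioms)
    fix i
    show "e i \<in> hom (G i) amalgam"
      using inl_hom inr_hom by (cases i) (auto simp: hom_def G_def e_def copy_monoid_def)
    show "e i \<one>\<^bsub>G i\<^esub> = \<one>\<^bsub>amalgam\<^esub>"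
      using inl_one inr_one by (cases i) (auto simp: G_def e_def copy_monoid_def)
    show "e i (r i) = e j (r j)" for j
      using roots_identified by (cases i; cases j) (auto simp: e_def r_def)
    show "(\<lambda>N. submonoid N amalgam) hull (e True ` carrier (G True) \<union> e False ` carrier (G False)) = carrier amalgam"
      using amalgam_generators by (simp add: e_def G_def copy_monoid_def image_image)
    show "\<Phi> \<one>\<^bsub>amalgam\<^esub> = id" using \<Phi>(2) by (simp add: P_def)
    show "\<Phi> (x \<otimes>\<^bsub>amalgam\<^esub> y) = \<Phi> x \<circ> \<Phi> y" if "x \<in> carrier amalgam" "y \<in> carrier amalgam" for x y
      using hom_mult[OF \<Phi>(1) that] by (simp add: P_def)
    show "\<Phi> (e i a) = nf.act i a" if "a \<in> carrier (G i)" for a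
      using that \<Phi>(3,4) by (cases i) (auto simp: G_def e_def copy_monoid_def)
  qed
  then show ?thesis using amalgam_presentation.free_amalgam by blast
qed

theorem theorem3p2:
  fixes M1 :: "('a, 'm) monoid_scheme" and M2 :: "('b, 'n) monoid_scheme"
    and g1 h1 :: 'a and g2 h2 :: 'b
  assumes "garside_monoid M1" and "garside_monoid M2"
    and "garside_element M1 g1" and "is_root M1 h1 g1"
    and "garside_element M2 g2" and "is_root M2 h2 g2"
    and "inj (\<lambda>k::nat. h1 [^]\<^bsub>M1\<^esub> k)" and "inj (\<lambda>k::nat. h2 [^]\<^bsub>M2\<^esub> k)"
  shows "garside_monoid (cyclic_amalgam M1 M2 h1 h2)"
proof -
  interpret M1: garside_monoid M1 by (rule assms(1))
  interpret M2: garside_monoid M2 by (rule assms(2))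
  have "h1 \<in> carrier M1" "h2 \<in> carrier M2" using assms(4,6) by (auto simp: is_root_def)
  then have "h1 \<noteq> \<one>\<^bsub>M1\<^esub>" "h2 \<noteq> \<one>\<^bsub>M2\<^esub>"
    using injD[OF assms(7), of 1 0] injD[OF assms(8), of 1 0] by auto
  then have "rooted_monoid M1 h1" "rooted_monoid M2 h2"
    using M1.rooted_at_garside_root[OF assms(3,4)] M2.rooted_at_garside_root[OF assms(5,6)] by auto
  then obtain A T h where "free_amalgam (cyclic_amalgam M1 M2 h1 h2) A T h"
    using cyclic_amalgam_free[of M1 h1 M2 h2] by blast
  then show ?thesis by (rule free_amalgam.amalgam_garside)
qed

end
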